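(* Let $\mathcal{H}_A,\mathcal{H}_B$ be finite-dimensional Hilbert spaces, $\rho_{AB}\in\mathcal{S}(\mathcal{H}_{AB})$, $0<\varepsilon\le\sqrt2$, and $\eta=\Upsilon(A|B)_{\rho|\rho}$. Let $n\in\mathbb{N}$ satisfy $n\ge\frac85\log\frac{2}{\varepsilon^2}$, and let $\rho_{AB}^{\otimes n}$ be the i.i.d. state on $\mathcal{H}_{AB}^{\otimes n}$, viewed as a bipartite state on $\mathcal{H}_A^{\otimes n}\otimes\mathcal{H}_B^{\otimes n}$ (systems $A^n$, $B^n$). Then $$\frac1n H_{\min}^{\varepsilon}(A^n|B^n)_{\rho^{\otimes n}}\ \ge\ H(A|B)_\rho-\frac{\delta(\varepsilon,\eta)}{\sqrt n},\qquad\text{where}\quad \delta(\varepsilon,\eta):=4\log\eta\,\sqrt{\log\frac{2}{\varepsilon^2}} .$$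
   Context: All Hilbert spaces are finite-dimensional; $\log$ is the binary logarithm. For a Hilbert space $\mathcal{H}$, $\mathcal{S}(\mathcal{H})$ denotes the positive semi-definite operators of trace $1$ and $\mathcal{S}_{\le}(\mathcal{H})$ those of trace at most $1$. Write $\mathcal{H}_{AB}=\mathcal{H}_A\otimes\mathcal{H}_B$; marginals are partial traces, e.g. $\rho_B=\mathrm{tr}_A(\rho_{AB})$. $\mathbb{1}$ denotes an identity operator. A subscript $\rho|\rho$ means that $\sigma_B=\rho_B$ in the quantities below. Conditional von Neumann entropy: for $\rho_{AB}\in\mathcal{S}(\mathcal{H}_{AB})$ and $\sigma_B\in\mathcal{S}(\mathcal{H}_B)$, $H(A|B)_{\rho|\sigma}:=\lim_{\xi\to0^+}\mathrm{tr}\big(\rho_{AB}(\mathbb{1}_A\otimes\log(\sigma_B+\xi\mathbb{1}_B)-\log\rho_{AB})\big)$ (with $0\log0=0$), and $H(A|B)_\rho:=\max_{\sigma_B\in\mathcal{S}(\mathcal{H}_B)}H(A|B)_{\rho|\sigma}=H(A|B)_{\rho|\rho}$. $\alpha$-entropy: for $\rho_{AB}\in\mathcal{S}(\mathcal{H}_{AB})$, $\sigma_B\in\mathcal{S}(\mathcal{H}_B)$, $\alpha\in(0,1)\cup(1,\infty)$, $H_\alpha(A|B)_{\rho|\sigma}:=\frac{1}{1-\alpha}\log\mathrm{tr}\big(\rho_{AB}^\alpha(\mathbb{1}_A\otimes\sigma_B)^{1-\alpha}\big)$ if $\sigma_B$ is invertible, and otherwise the limit as $\xi\to0^+$ of the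 same expression with $\sigma_B$ replaced by $\sigma_B+\xi\mathbb{1}_B$. Convergence parameter: $\Upsilon(A|B)_{\rho|\sigma}:=2^{-\frac12H_{3/2}(A|B)_{\rho|\sigma}}+2^{\frac12H_{1/2}(A|B)_{\rho|\sigma}}+1$. Min-entropy: for $\rho_{AB}\in\mathcal{S}_\le(\mathcal{H}_{AB})$ and $\sigma_B\in\mathcal{S}(\mathcal{H}_B)$, $H_{\min}(A|B)_{\rho|\sigma}:=\sup\{\lambda\in\mathbb{R}:2^{-\lambda}\,\mathbb{1}_A\otimes\sigma_B\ge\rho_{AB}\}$ (equal to $-\infty$ if no such $\lambda$ exists, and $+\infty$ if $\rho_{AB}=0$), and $H_{\min}(A|B)_\rho:=\max_{\sigma_B\in\mathcal{S}(\mathcal{H}_B)}H_{\min}(A|B)_{\rho|\sigma}$. Smoothing: for $\varepsilon>0$ and $\rho\in\mathcal{S}(\mathcal{H})$, $\mathcal{B}^\varepsilon(\rho):=\{\tilde\rho\in\mathcal{S}_\le(\mathcal{H}):C(\rho,\tilde\rho)\le\varepsilon\}$ with $C(\rho,\tilde\rho):=\sqrt{1-F^2(\rho,\tilde\rho)}$ and $F(\rho,\tilde\rho):=\mathrm{tr}|\sqrt\rho\sqrt{\tilde\rho}|$. Then $H_{\min}^\varepsilon(A|B)_\rho:=\max_{\tilde\rho_{AB}\in\mathcal{B}^\varepsilon(\rho_{AB})}H_{\min}(A|B)_{\tilde\rho}$. *)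

theory Defs
  imports "HOL-Analysis.Analysis"
begin

text \<open>
  A finite-dimensional Hilbert space is \<open>\<complex>\<close> indexed by a finite type, i.e. \<open>complex ^ 'i\<close> with its
  standard basis; operators on it are the matrices \<open>complex ^ 'i ^ 'i\<close>. The tensor product of the
  spaces indexed by \<open>'a\<close> and \<open>'b\<close> is indexed by \<open>'a \<times> 'b\<close>, and the tensor power with one factor for
  each element of \<open>'k\<close> is indexed by \<open>'k \<Rightarrow> 'a\<close>.
\<close>

type_synonym 'i operator = "complex ^ 'i ^ 'i"

definition adj :: "'i::finite operator \<Rightarrow> 'i operator" where
  "adj M = (\<chi> i j. cnj (M $ j $ i))"

definition psd :: "'i::finite operator \<Rightarrow> bool" where
  "psd M \<longleftrightarrow> adj M = M \<and> (\<forall>v. 0 \<le> Re (\<Sum>i\<in>UNIV. cnj (v $ i) * (M *v v) $ i))"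

definition unitary_op :: "'i::finite operator \<Rightarrow> bool" where
  "unitary_op U \<longleftrightarrow> adj U ** U = mat 1 \<and> U ** adj U = mat 1"

definition diag_op :: "('i::finite \<Rightarrow> real) \<Rightarrow> 'i operator" where
  "diag_op d = (\<chi> i j. if i = j then of_real (d i) else 0)"

text \<open>
  Functional calculus of a Hermitian operator: \<open>f\<close> is applied to the eigenvalues in a spectral
  decomposition; the result does not depend on the decomposition chosen.
\<close>

definition op_fun :: "(real \<Rightarrow> real) \<Rightarrow> 'i::finite operator \<Rightarrow> 'i operator" where
  "op_fun f M = (THE N. \<exists>U d. unitary_op U \<and> M = U ** diag_op d ** adj U \<and>
                              N = U ** diag_op (\<lambda>i. f (d i)) ** adj U)"

definition op_powr :: "'i::finite operator \<Rightarrow> real \<Rightarrow> 'i operator" where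
  "op_powr M \<alpha> = op_fun (\<lambda>x. x powr \<alpha>) M"

definition op_sqrt :: "'i::finite operator \<Rightarrow> 'i operator" where
  "op_sqrt M = op_fun sqrt M"

text \<open>
  In the library \<open>log 2 0 = 0\<close>, so \<open>op_log\<close> vanishes on the kernel of its argument, which
  implements the convention \<open>0 log 0 = 0\<close> in \<open>tr (\<rho> log \<rho>)\<close>.
\<close>

definition op_log :: "'i::finite operator \<Rightarrow> 'i operator" where
  "op_log M = op_fun (log 2) M"

definition op_abs :: "'i::finite operator \<Rightarrow> 'i operator" where
  "op_abs M = op_sqrt (adj M ** M)"

definition states :: "'i::finite operator set" where
  "states = {\<rho>. psd \<rho> \<and> trace \<rho> = 1}"

definition substates :: "'i::finite operator set" where
  "substates = {\<rho>. psd \<rho> \<and> Re (trace \<rho>) \<le> 1}"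

definition kron :: "'a::finite operator \<Rightarrow> 'b::finite operator \<Rightarrow> ('a \<times> 'b) operator" where
  "kron M N = (\<chi> p q. M $ fst p $ fst q * N $ snd p $ snd q)"

definition ptrace_A :: "('a::finite \<times> 'b::finite) operator \<Rightarrow> 'b operator" where
  "ptrace_A M = (\<chi> b b'. \<Sum>a\<in>UNIV. M $ (a, b) $ (a, b'))"

definition tensor_power :: "'i::finite operator \<Rightarrow> ('k::finite \<Rightarrow> 'i) operator" where
  "tensor_power M = (\<chi> x y. \<Prod>k\<in>UNIV. M $ x k $ y k)"

text \<open>
  The canonical identification of \<open>(A \<otimes> B)\<^sup>n\<close> with \<open>A\<^sup>n \<otimes> B\<^sup>n\<close>, which only permutes the
  tensor factors.
\<close>

definition regroup ::
    "('k::finite \<Rightarrow> 'a::finite \<times> 'b::finite) operator \<Rightarrow> (('k \<Rightarrow> 'a) \<times> ('k \<Rightarrow> 'b)) operator" where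
  "regroup M = (\<chi> p q. M $ (\<lambda>k. (fst p k, snd p k)) $ (\<lambda>k. (fst q k, snd q k)))"

text \<open>
  Entropies take values in the extended reals: the limits below are \<open>-\<infinity>\<close> when the support of
  \<open>\<rho>\<close> is not suitably contained in (or is orthogonal to) that of \<open>1 \<otimes> \<sigma>\<close>. The traces involved
  are real numbers, and a maximum is rendered as a supremum.
\<close>

definition cond_entropy_rel :: "('a::finite \<times> 'b::finite) operator \<Rightarrow> 'b operator \<Rightarrow> ereal" where
  "cond_entropy_rel \<rho> \<sigma> = Lim (at_right 0) (\<lambda>\<xi>::real.
     ereal (Re (trace (\<rho> ** (kron (mat 1) (op_log (\<sigma> + \<xi> *\<^sub>R mat 1)) - op_log \<rho>)))))"

definition cond_entropy :: "('a::finite \<times> 'b::finite) operator \<Rightarrow> ereal" where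
  "cond_entropy \<rho> = (SUP \<sigma>\<in>states. cond_entropy_rel \<rho> \<sigma>)"

definition alpha_entropy_inv ::
    "real \<Rightarrow> ('a::finite \<times> 'b::finite) operator \<Rightarrow> 'b operator \<Rightarrow> real" where
  "alpha_entropy_inv \<alpha> \<rho> \<sigma> =
     1 / (1 - \<alpha>) * log 2 (Re (trace (op_powr \<rho> \<alpha> ** op_powr (kron (mat 1) \<sigma>) (1 - \<alpha>))))"

definition alpha_entropy ::
    "real \<Rightarrow> ('a::finite \<times> 'b::finite) operator \<Rightarrow> 'b operator \<Rightarrow> ereal" where
  "alpha_entropy \<alpha> \<rho> \<sigma> =
     (if invertible \<sigma> then ereal (alpha_entropy_inv \<alpha> \<rho> \<sigma>)
      else Lim (at_right 0) (\<lambda>\<xi>::real. ereal (alpha_entropy_inv \<alpha> \<rho> (\<sigma> + \<xi> *\<^sub>R mat 1))))"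

fun pow2 :: "ereal \<Rightarrow> ereal" where
  "pow2 (ereal x) = ereal (2 powr x)"
| "pow2 PInfty = \<infinity>"
| "pow2 MInfty = 0"

definition Upsilon :: "('a::finite \<times> 'b::finite) operator \<Rightarrow> 'b operator \<Rightarrow> ereal" where
  "Upsilon \<rho> \<sigma> = pow2 (ereal (- (1 / 2)) * alpha_entropy (3 / 2) \<rho> \<sigma>)
               + pow2 (ereal (1 / 2) * alpha_entropy (1 / 2) \<rho> \<sigma>) + 1"

definition min_entropy_rel :: "('a::finite \<times> 'b::finite) operator \<Rightarrow> 'b operator \<Rightarrow> ereal" where
  "min_entropy_rel \<rho> \<sigma> =
     Sup (ereal ` {l::real. psd ((2 powr (- l)) *\<^sub>R kron (mat 1) \<sigma> - \<rho>)})"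

definition min_entropy :: "('a::finite \<times> 'b::finite) operator \<Rightarrow> ereal" where
  "min_entropy \<rho> = (SUP \<sigma>\<in>states. min_entropy_rel \<rho> \<sigma>)"

definition fidelity :: "'i::finite operator \<Rightarrow> 'i operator \<Rightarrow> real" where
  "fidelity \<rho> \<tau> = Re (trace (op_abs (op_sqrt \<rho> ** op_sqrt \<tau>)))"

definition purified_dist :: "'i::finite operator \<Rightarrow> 'i operator \<Rightarrow> real" where
  "purified_dist \<rho> \<tau> = sqrt (1 - (fidelity \<rho> \<tau>)\<^sup>2)"

definition eps_ball :: "real \<Rightarrow> 'i::finite operator \<Rightarrow> 'i operator set" where
  "eps_ball \<epsilon> \<rho> = {\<tau> \<in> substates. purified_dist \<rho> \<tau> \<le> \<epsilon>}"

definition smooth_min_entropy :: "real \<Rightarrow> ('a::finite \<times> 'b::finite) operator \<Rightarrow> ereal" where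
  "smooth_min_entropy \<epsilon> \<rho> = (SUP \<tau>\<in>eps_ball \<epsilon> \<rho>. min_entropy \<tau>)"

definition delta :: "real \<Rightarrow> real \<Rightarrow> real" where
  "delta \<epsilon> \<eta> = 4 * log 2 \<eta> * sqrt (log 2 (2 / \<epsilon>\<^sup>2))"

end

theory Submission
  imports Defs
begin

text \<open>
  Let \<open>\<Lambda> = 2\<^sup>-\<^sup>m (1 \<otimes> \<sigma>)\<close> and let \<open>Y\<close> solve the Sylvester equation \<open>\<Lambda> Y + Y \<rho> = \<Lambda>\<close>. The operator
  arithmetic-geometric mean inequality shows \<open>Y \<rho> Y\<^sup>\<dagger> \<le> \<Lambda>\<close>, and the fidelity of \<open>\<rho>\<close> and
  \<open>Y \<rho> Y\<^sup>\<dagger>\<close> is at least \<open>Re tr (Y \<rho>)\<close>. In the eigenbases of \<open>\<rho>\<close> (eigenvalues \<open>r\<close>) and \<open>\<Lambda>\<close>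
  (eigenvalues \<open>l\<close>), \<open>Y\<close> is the entrywise multiplier \<open>l / (l + r)\<close>, so \<open>1 - Re tr (Y \<rho>)\<close> is the
  expectation of \<open>r / (l + r) \<le> (r / l)\<^sup>t\<close> under the classical weights \<open>r |\<langle>v|u\<rangle>|\<^sup>2\<close>, that is, at most
  \<open>tr (\<rho>\<^sup>1\<^sup>+\<^sup>t \<Lambda>\<^sup>-\<^sup>t)\<close>. This is multiplicative for i.i.d. states. A second-order expansion in \<open>t\<close>,
  whose remainder is controlled by Jensen's inequality for \<open>z \<mapsto> z\<^sup>2\<^sup>t + z\<^sup>-\<^sup>2\<^sup>t\<close>, concave on
  \<open>[3, \<infinity>)\<close> when \<open>t \<le> 1/4\<close>, bounds one factor by the entropy and \<open>\<Upsilon>\<close>; then \<open>t\<close> is optimised.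
\<close>

section \<open>Matrices over the complex numbers and the real inner product\<close>

lemma adj_nth [simp]: "adj M $ i $ j = cnj (M $ j $ i)"
  by (simp add: adj_def)

lemma adj_adj [simp]: "adj (adj M) = M"
  by (simp add: vec_eq_iff)

lemma adj_mult: "adj (A ** B) = adj B ** adj A"
  by (simp add: vec_eq_iff matrix_matrix_mult_def mult.commute)

lemma adj_mat1 [simp]: "adj (mat 1) = mat 1"
  by (simp add: vec_eq_iff mat_def)

lemma diag_op_nth: "diag_op d $ i $ j = (if i = j then of_real (d i) else 0)"
  by (simp add: diag_op_def)

lemma adj_diag_op [simp]: "adj (diag_op d) = diag_op d"
  by (auto simp: vec_eq_iff diag_op_nth)

lemma mult_diag_op_nth: "(A ** diag_op d) $ i $ j = A $ i $ j * of_real (d j)"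
  by (simp add: matrix_matrix_mult_def diag_op_nth if_distrib cong: if_cong)

lemma diag_op_mult_nth: "(diag_op d ** A) $ i $ j = of_real (d i) * A $ i $ j"
  by (simp add: matrix_matrix_mult_def diag_op_nth if_distrib if_distribR cong: if_cong)

lemma diag_op_mult: "diag_op d ** diag_op e = diag_op (\<lambda>i. d i * e i)"
  by (auto simp: vec_eq_iff mult_diag_op_nth diag_op_nth)

lemma diag_op_one: "diag_op (\<lambda>i. 1) = mat 1"
  by (auto simp: vec_eq_iff diag_op_nth mat_def)

lemma diag_op_diff: "diag_op d - diag_op e = diag_op (\<lambda>i. d i - e i)"
  by (auto simp: vec_eq_iff diag_op_nth)

lemma diag_op_scaleR: "c *\<^sub>R diag_op d = diag_op (\<lambda>i. c * d i)"
  by (auto simp: vec_eq_iff diag_op_nth scaleR_conv_of_real[where 'a=complex])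

lemma diag_op_add: "diag_op d + diag_op e = diag_op (\<lambda>i. d i + e i)"
  by (auto simp: vec_eq_iff diag_op_nth)

lemma scaleR_matrix_mult: "(c *\<^sub>R A) ** B = c *\<^sub>R (A ** B)" "A ** (c *\<^sub>R B) = c *\<^sub>R (A ** B)"
  for A B :: "'i::finite operator"
  by (simp_all add: vec_eq_iff matrix_matrix_mult_def scaleR_sum_right)

text \<open>The library inner product on complex vectors is real bilinear: it is the real part of
  the Hermitian form. This suffices for positivity, because Hermitian matrices have real quadratic
  forms.\<close>

lemma inner_complex_vec: "v \<bullet> w = Re (\<Sum>i\<in>UNIV. cnj (v $ i) * w $ i)" for v w :: "complex ^ 'i::finite"
  by (simp add: inner_vec_def inner_complex_def)

lemma inner_matrix_vector: "v \<bullet> (M *v w) = Re (\<Sum>i\<in>UNIV. \<Sum>j\<in>UNIV. cnj (v $ i) * M $ i $ j * w $ j)"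
  for v w :: "complex ^ 'i::finite"
  by (simp add: inner_complex_vec matrix_vector_mult_def sum_distrib_left mult.assoc)

lemma inner_adj: "v \<bullet> (M *v w) = (adj M *v v) \<bullet> w" for v w :: "complex ^ 'i::finite"
proof -
  have "(\<Sum>i\<in>UNIV. \<Sum>j\<in>UNIV. cnj (v $ i) * M $ i $ j * w $ j)
      = (\<Sum>j\<in>UNIV. \<Sum>i\<in>UNIV. cnj (v $ i) * M $ i $ j * w $ j)"
    by (rule sum.swap)
  also have "\<dots> = (\<Sum>j\<in>UNIV. cnj ((adj M *v v) $ j) * w $ j)"
    by (simp add: matrix_vector_mult_def sum_distrib_right sum_distrib_left mult.commute)
  finally show ?thesis
    by (subst inner_matrix_vector) (simp only: inner_complex_vec)
qed

lemma psd_iff: "psd M \<longleftrightarrow> adj M = M \<and> (\<forall>v. 0 \<le> v \<bullet> (M *v v))"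
  by (simp add: psd_def inner_complex_vec)

lemma psd_congruence:
  assumes "psd M" shows "psd (X ** M ** adj X)"
proof -
  have "v \<bullet> ((X ** M ** adj X) *v v) = (adj X *v v) \<bullet> (M *v (adj X *v v))" for v
    by (simp add: matrix_vector_mul_assoc [symmetric] inner_adj)
  with assms show ?thesis
    by (simp add: psd_iff adj_mult matrix_mul_assoc)
qed

lemma inner_diag_op: "v \<bullet> (diag_op d *v v) = (\<Sum>i\<in>UNIV. d i * (cmod (v $ i))\<^sup>2)"
proof -
  have "v \<bullet> (diag_op d *v v) = (\<Sum>i\<in>UNIV. Re (cnj (v $ i) * (of_real (d i) * v $ i)))"
    by (simp add: inner_complex_vec matrix_vector_mult_def diag_op_nth if_distrib if_distribR cong: if_cong)
  also have "\<dots> = (\<Sum>i\<in>UNIV. d i * (cmod (v $ i))\<^sup>2)"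
    by (intro sum.cong refl, unfold cmod_power2) (simp add: power2_eq_square algebra_simps)
  finally show ?thesis .
qed

lemma psd_diag_op: "psd (diag_op d)" if "\<And>i. 0 \<le> d i"
  using that by (auto simp: psd_iff inner_diag_op intro!: sum_nonneg)

lemma psd_zero: "psd 0"
  by (simp add: psd_iff vec_eq_iff)

lemma unitary_op_adj: "unitary_op U \<Longrightarrow> unitary_op (adj U)"
  by (simp add: unitary_op_def)

lemma unitary_op_mult:
  assumes "unitary_op U" "unitary_op V" shows "unitary_op (U ** V)"
proof -
  have "adj (U ** V) ** (U ** V) = adj V ** (adj U ** U) ** V"
    "(U ** V) ** adj (U ** V) = U ** (V ** adj V) ** adj U"
    by (simp_all add: adj_mult matrix_mul_assoc)
  with assms show ?thesis by (simp add: unitary_op_def)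
qed

lemma unitary_cancel:
  assumes "unitary_op U"
  shows "X ** adj U ** U = X" "X ** U ** adj U = X" "adj U ** (U ** X) = X" "U ** (adj U ** X) = X"
  using assms by (simp_all add: unitary_op_def matrix_mul_assoc[symmetric])
    (simp_all add: unitary_op_def matrix_mul_assoc)

section \<open>Spectral theorem and functional calculus\<close>

text \<open>A maximiser of the Rayleigh quotient on the unit sphere of the invariant subspace is an
  eigenvector: moving it along the residual \<open>e\<close> would otherwise raise the
  quotient.\<close>

lemma self_adjoint_eigenvector:
  fixes f :: "'v::euclidean_space \<Rightarrow> 'v"
  assumes lin: "linear f" and sa: "\<And>x y. f x \<bullet> y = x \<bullet> f y"
    and W: "subspace W" "f ` W \<subseteq> W" and x: "x \<in> W" "x \<noteq> 0"
  obtains v l where "v \<in> W" "norm v = 1" "f v = l *\<^sub>R v"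
proof -
  let ?S = "sphere 0 1 \<inter> W"
  have "compact ?S"
    by (intro compact_Int_closed compact_sphere closed_subspace W)
  moreover have "(1 / norm x) *\<^sub>R x \<in> ?S"
    using x W(1) by (simp add: subspace_scale)
  moreover have "continuous_on ?S (\<lambda>v. v \<bullet> f v)"
    using lin by (intro continuous_intros linear_continuous_on linear_conv_bounded_linear[THEN iffD1])
  ultimately obtain v where v: "v \<in> ?S" and max: "\<And>w. w \<in> ?S \<Longrightarrow> w \<bullet> f w \<le> v \<bullet> f v"
    using continuous_attains_sup[of ?S "\<lambda>v. v \<bullet> f v"] by blast
  define l where "l = v \<bullet> f v"
  have nv: "norm v = 1" and vW: "v \<in> W" using v by auto
  have q: "w \<bullet> f w \<le> l * (w \<bullet> w)" if "w \<in> W" for w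
  proof (cases "w = 0")
    case False
    have "((1 / norm w) *\<^sub>R w) \<bullet> f ((1 / norm w) *\<^sub>R w) \<le> l"
      unfolding l_def using False that W(1) by (intro max) (simp add: subspace_scale)
    then have "(w \<bullet> f w) / (norm w)\<^sup>2 \<le> l"
      by (simp add: linear_cmul[OF lin] power2_eq_square)
    then show ?thesis
      using False by (simp add: pos_divide_le_eq dot_square_norm)
  qed (simp add: linear_0[OF lin])
  define e where "e = l *\<^sub>R v - f v"
  have eW: "e \<in> W"
    using vW W by (auto simp: e_def intro!: subspace_diff subspace_scale)
  define Q where "Q = l * (e \<bullet> e) - e \<bullet> f e"
  have Q: "Q \<ge> 0" using q[OF eW] by (simp add: Q_def)
  have vv: "v \<bullet> v = 1" using nv by (simp add: dot_square_norm)
  have quad: "0 \<le> 2 * t * (e \<bullet> e) + t\<^sup>2 * Q" for t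
  proof -
    have "v + t *\<^sub>R e \<in> W" using vW eW W(1) by (simp add: subspace_add subspace_scale)
    from q[OF this] have "0 \<le> l * ((v + t *\<^sub>R e) \<bullet> (v + t *\<^sub>R e)) - (v + t *\<^sub>R e) \<bullet> f (v + t *\<^sub>R e)"
      by simp
    also have "\<dots> = l * (v \<bullet> v) - v \<bullet> f v + 2 * t * (l * (v \<bullet> e) - f v \<bullet> e) + t\<^sup>2 * Q"
      by (simp add: linear_add[OF lin] linear_cmul[OF lin] inner_add_left inner_add_right Q_def
          inner_commute[of e v] sa[symmetric] inner_commute[of e "f v"]
          algebra_simps power2_eq_square) (metis inner_commute sa)
    also have "l * (v \<bullet> e) - f v \<bullet> e = e \<bullet> e"
      by (simp add: e_def inner_diff_left inner_diff_right algebra_simps)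
    finally show ?thesis by (simp add: vv l_def)
  qed
  have "e \<bullet> e = 0"
  proof (rule ccontr)
    assume "e \<bullet> e \<noteq> 0"
    then have b: "e \<bullet> e > 0" by simp
    \<comment> \<open>At \<open>t = - c\<close> the quadratic in \<open>quad\<close> becomes
      \<open>- (c\<^sup>2 * (Q + 2))\<close>; the denominator \<open>Q + 1\<close> stays positive
      even if \<open>Q = 0\<close>.\<close>
    define c where "c = (e \<bullet> e) / (Q + 1)"
    have c: "e \<bullet> e = c * (Q + 1)" "c > 0"
      using Q b by (simp_all add: c_def)
    have "0 \<le> 2 * (- c) * (c * (Q + 1)) + (- c)\<^sup>2 * Q"
      using quad[of "- c"] unfolding c(1) .
    also have "\<dots> = - (c\<^sup>2 * (Q + 2))"
      by (simp add: algebra_simps power2_eq_square)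
    also have "\<dots> < 0"
      using Q c by simp
    finally show False by simp
  qed
  then have "f v = l *\<^sub>R v" by (simp add: e_def)
  then show thesis using that vW nv by blast
qed

lemma linear_matrix_vector_complex: "linear ((*v) M)" for M :: "'i::finite operator"
  by (rule linearI) (simp_all add: matrix_vector_right_distrib, simp add: vec_eq_iff matrix_vector_mult_def
      scaleR_sum_right)

lemma inner_ii_self: "(\<i> *s v) \<bullet> v = 0" for v :: "complex ^ 'i::finite"
  by (simp add: inner_vec_def inner_complex_def)

lemma inner_ii_commute: "(\<i> *s v) \<bullet> w = - ((\<i> *s w) \<bullet> v)" for v w :: "complex ^ 'i::finite"
  unfolding inner_vec_def sum_negf[symmetric]
  by (rule sum.cong) (simp_all add: inner_complex_def algebra_simps)

text \<open>Complex orthogonality amounts to two real conditions, orthogonality to \<open>v\<close>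
  and to \<open>\<i> *s v\<close>. This links the real eigenvector argument to unitary
  matrices.\<close>

lemma cinner_eq: "(\<Sum>i\<in>UNIV. cnj (v $ i) * w $ i) = Complex (v \<bullet> w) ((\<i> *s v) \<bullet> w)"
  for v w :: "complex ^ 'i::finite"
  by (simp add: complex_eq_iff inner_vec_def inner_complex_def)

text \<open>Induction over the eigenvectors found so far. They and their multiples by
  \<open>\<i>\<close> span a real space of dimension at most \<open>2 * card K\<close>, less than
  that of the whole space, so the orthogonal complement is a nonzero invariant subspace and holds a
  further eigenvector.\<close>

lemma spectral_aux:
  fixes M :: "'i::finite operator"
  assumes M: "adj M = M"
  shows "finite K \<Longrightarrow> \<exists>(u :: 'i \<Rightarrow> complex ^ 'i) d.
     (\<forall>k\<in>K. M *v u k = d k *\<^sub>R u k \<and> norm (u k) = 1) \<and>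
     (\<forall>k\<in>K. \<forall>l\<in>K. k \<noteq> l \<longrightarrow> u k \<bullet> u l = 0 \<and> (\<i> *s u k) \<bullet> u l = 0)"
proof (induction K rule: finite_induct)
  case (insert k K)
  obtain u :: "'i \<Rightarrow> complex ^ 'i" and d where
    *: "(\<forall>k\<in>K. M *v u k = d k *\<^sub>R u k \<and> norm (u k) = 1) \<and>
     (\<forall>k\<in>K. \<forall>l\<in>K. k \<noteq> l \<longrightarrow> u k \<bullet> u l = 0 \<and> (\<i> *s u k) \<bullet> u l = 0)"
    using insert.IH by (elim exE)
  then have
    eig: "\<And>k. k \<in> K \<Longrightarrow> M *v u k = d k *\<^sub>R u k \<and> norm (u k) = 1" and
    orth: "\<And>k l. k \<in> K \<Longrightarrow> l \<in> K \<Longrightarrow> k \<noteq> l \<Longrightarrow> u k \<bullet> u l = 0 \<and> (\<i> *s u k) \<bullet> u l = 0"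
    by simp_all
  define T where "T = u ` K \<union> (\<lambda>k. \<i> *s u k) ` K"
  have "dim T \<le> card T" by (rule dim_le_card') (simp add: T_def insert)
  also have "card T \<le> 2 * card K"
    unfolding T_def using card_Un_le card_image_le[OF insert(1)]
    by (smt (verit) add_mono le_trans mult_2)
  also have "\<dots> < DIM(complex ^ 'i)"
    using psubset_card_mono[of UNIV K] insert by auto
  finally obtain x where x: "x \<noteq> 0" "\<And>y. y \<in> span T \<Longrightarrow> orthogonal x y"
    by (rule orthogonal_to_subspace_exists) auto
  define W where "W = {w. \<forall>y\<in>T. y \<bullet> w = 0}"
  have sub: "subspace W"
    by (auto simp: W_def subspace_def inner_right_distrib)
  have xW: "x \<in> W"
    using x(2) by (auto simp: W_def orthogonal_def inner_commute span_base)
  have sa: "(M *v v) \<bullet> w = v \<bullet> (M *v w)" for v w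
    using inner_adj[of v M w] M by simp
  have Mii: "M *v (\<i> *s v) = \<i> *s (M *v v)" for v
    by (simp add: vector_scalar_commute)
  have "(*v) M ` W \<subseteq> W"
  proof clarify
    fix w assume w: "w \<in> W"
    have "y \<bullet> (M *v w) = 0" if "y \<in> T" for y
    proof -
      from that consider l where "l \<in> K" "y = u l" | l where "l \<in> K" "y = \<i> *s u l"
        by (auto simp: T_def)
      then obtain c where "M *v y = c *\<^sub>R y"
      proof cases
        case (2 l)
        then have "M *v y = d l *\<^sub>R y"
          by (simp only: Mii eig) (simp add: vec_eq_iff)
        then show ?thesis using that by blast
      qed (use eig that in blast)
      then have "y \<bullet> (M *v w) = c * (y \<bullet> w)" by (simp add: sa[symmetric])
      then show ?thesis using w that by (simp add: W_def)
    qed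
    then show "M *v w \<in> W" by (simp add: W_def)
  qed
  then obtain v l where v: "v \<in> W" "norm v = 1" "M *v v = l *\<^sub>R v"
    using self_adjoint_eigenvector[OF linear_matrix_vector_complex sa sub _ xW x(1)] by blast
  have vT: "u j \<bullet> v = 0" "(\<i> *s u j) \<bullet> v = 0" if "j \<in> K" for j
    using v(1) that by (auto simp: W_def T_def)
  have "v \<bullet> u j = 0" "(\<i> *s v) \<bullet> u j = 0" if "j \<in> K" for j
    using vT[OF that] by (auto simp: inner_commute[of v] inner_ii_commute[of v])
  with v vT eig orth insert(2) show ?case
    by (intro exI[of _ "u(k := v)"] exI[of _ "d(k := l)"]) auto
qed simp

lemma spectral_theorem:
  fixes M :: "'i::finite operator"
  assumes "adj M = M"
  obtains U d where "unitary_op U" "M = U ** diag_op d ** adj U"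
proof -
  obtain u :: "'i \<Rightarrow> complex ^ 'i" and d where
    eig: "\<And>k. M *v u k = d k *\<^sub>R u k" and nrm: "\<And>k. norm (u k) = 1" and
    orth: "\<And>k l. k \<noteq> l \<Longrightarrow> u k \<bullet> u l = 0 \<and> (\<i> *s u k) \<bullet> u l = 0"
    using that spectral_aux[OF assms finite, of UNIV] by auto metis
  define U where "U = (\<chi> i k. u k $ i)"
  have "(adj U ** U) $ k $ l = mat 1 $ k $ l" for k l
  proof -
    have "(adj U ** U) $ k $ l = Complex (u k \<bullet> u l) ((\<i> *s u k) \<bullet> u l)"
      by (simp add: U_def matrix_matrix_mult_def cinner_eq[symmetric])
    also have "\<dots> = mat 1 $ k $ l"
      using orth[of k l] nrm[of k] by (cases "k = l") (auto simp: mat_def inner_ii_self dot_square_norm one_complex.code zero_complex.code)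
    finally show ?thesis .
  qed
  then have UU: "adj U ** U = mat 1" by (simp add: vec_eq_iff)
  then have U: "unitary_op U"
    using matrix_left_right_inverse unfolding unitary_op_def by blast
  have "(M ** U) $ i $ k = (U ** diag_op d) $ i $ k" for i k
    using arg_cong[OF eig[of k], of "\<lambda>v. v $ i"]
    unfolding mult_diag_op_nth
    by (simp add: U_def matrix_matrix_mult_def matrix_vector_mult_def scaleR_conv_of_real[where 'a=complex] mult.commute)
  then have "M ** U = U ** diag_op d" by (simp add: vec_eq_iff)
  then have "M = U ** diag_op d ** adj U"
    using U by (metis unitary_cancel(2))
  then show thesis using that U by blast
qed

lemma unitary_conj_mult:
  assumes "unitary_op U"
  shows "(U ** A ** adj U) ** (U ** B ** adj U) = U ** (A ** B) ** adj U"
  by (simp add: matrix_mul_assoc unitary_cancel(1)[OF assms])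

text \<open>The matrix \<open>C = adj V ** U\<close> intertwines two diagonalisations, so a nonzero
  entry of \<open>C\<close> forces equal eigenvalues; \<open>C\<close> then intertwines their images
  under \<open>f\<close> too. Hence the description in \<open>op_fun\<close> is unique.\<close>

lemma op_fun_eq:
  assumes U: "unitary_op U" and M: "M = U ** diag_op d ** adj U"
  shows "op_fun f M = U ** diag_op (\<lambda>i. f (d i)) ** adj U"
  unfolding op_fun_def
proof (rule the_equality)
  show "\<exists>U' d'. unitary_op U' \<and> M = U' ** diag_op d' ** adj U' \<and>
      U ** diag_op (\<lambda>i. f (d i)) ** adj U = U' ** diag_op (\<lambda>i. f (d' i)) ** adj U'"
    using assms by blast
next
  fix N assume "\<exists>V e. unitary_op V \<and> M = V ** diag_op e ** adj V \<and>
                              N = V ** diag_op (\<lambda>i. f (e i)) ** adj V"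
  then obtain V e where V: "unitary_op V" and MV: "M = V ** diag_op e ** adj V"
    and N: "N = V ** diag_op (\<lambda>i. f (e i)) ** adj V" by blast
  define C where "C = adj V ** U"
  have "V ** diag_op e ** adj V ** U = U ** diag_op d ** adj U ** U"
    using M MV by simp
  then have "adj V ** (V ** (diag_op e ** adj V ** U)) = adj V ** (U ** diag_op d)"
    by (simp add: unitary_cancel[OF U] matrix_mul_assoc)
  then have "diag_op e ** C = C ** diag_op d"
    using V by (simp add: C_def matrix_mul_assoc unitary_op_def)
  then have "of_real (e i) * C $ i $ j = C $ i $ j * of_real (d j)" for i j
    by (simp add: vec_eq_iff diag_op_mult_nth mult_diag_op_nth)
  then have "C $ i $ j = 0 \<or> e i = d j" for i j
    by (simp add: mult.commute)
  then have "of_real (f (e i)) * C $ i $ j = C $ i $ j * of_real (f (d j))" for i j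
    by (metis mult.commute mult_zero_right)
  then have "diag_op (\<lambda>i. f (e i)) ** C = C ** diag_op (\<lambda>i. f (d i))"
    by (simp add: vec_eq_iff diag_op_mult_nth mult_diag_op_nth)
  then have "V ** (diag_op (\<lambda>i. f (e i)) ** C) ** adj U = V ** (C ** diag_op (\<lambda>i. f (d i))) ** adj U"
    by simp
  then show "N = U ** diag_op (\<lambda>i. f (d i)) ** adj U"
    using V by (simp add: C_def N matrix_mul_assoc unitary_cancel(2)[OF U] unitary_op_def)
qed

lemma psd_eigenvalue_nonneg:
  assumes "psd (U ** diag_op d ** adj U)" "unitary_op U" shows "0 \<le> d i"
proof -
  have "psd (adj U ** (U ** diag_op d ** adj U) ** adj (adj U))"
    using assms(1) by (rule psd_congruence)
  then have "psd (diag_op d)"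
    using assms(2) by (simp add: matrix_mul_assoc unitary_cancel) (simp add: unitary_op_def)
  then have "0 \<le> axis i 1 \<bullet> (diag_op d *v axis i 1)"
    by (simp add: psd_iff)
  moreover have "(cmod ((axis i 1 :: complex ^ 'a) $ j))\<^sup>2 = (if j = i then 1 else 0)" for j
    by (simp add: axis_def)
  ultimately show ?thesis
    by (simp add: inner_diag_op if_distrib cong: if_cong)
qed

lemma psd_decomposition:
  assumes "psd M"
  obtains U d where "unitary_op U" "M = U ** diag_op d ** adj U" "\<And>i. 0 \<le> d i"
proof -
  obtain U d where "unitary_op U" "M = U ** diag_op d ** adj U"
    using assms spectral_theorem by (auto simp: psd_iff)
  with that psd_eigenvalue_nonneg[of U d] assms show thesis by blast
qed

lemma trace_unitary_conj: "unitary_op U \<Longrightarrow> trace (U ** A ** adj U) = trace A"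
  by (subst trace_mul_sym) (simp add: matrix_mul_assoc unitary_op_def)

lemma trace_diag_op: "trace (diag_op d) = of_real (\<Sum>i\<in>UNIV. d i)"
  by (simp add: trace_def diag_op_nth)

section \<open>A lower bound on the fidelity\<close>

lemma matrix_diff_distrib: "(A - B) ** C = A ** C - B ** C" "A ** (B - C) = A ** B - A ** C"
  for A B C :: "'i::finite operator"
  by (simp_all add: vec_eq_iff matrix_matrix_mult_def algebra_simps sum_subtractf)

lemma matrix_mult_zero: "0 ** A = 0" "A ** 0 = 0" for A :: "'i::finite operator"
  by (simp_all add: vec_eq_iff matrix_matrix_mult_def)

lemma norm_matrix_vector_sq: "(norm (M *v v))\<^sup>2 = v \<bullet> ((adj M ** M) *v v)"
proof -
  have "(norm (M *v v))\<^sup>2 = (adj M *v (M *v v)) \<bullet> v"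
    by (simp only: dot_square_norm[symmetric] inner_adj)
  then show ?thesis by (simp add: matrix_vector_mul_assoc inner_commute)
qed

lemma norm_unitary_op: "unitary_op U \<Longrightarrow> norm (U *v v) = norm v"
  using norm_matrix_vector_sq[of U v] by (simp add: unitary_op_def dot_square_norm)

lemma psd_mult_adj: "psd (A ** adj A)"
proof -
  have "psd (A ** mat 1 ** adj A)"
    by (rule psd_congruence) (simp add: psd_iff)
  then show ?thesis by simp
qed

lemma mult_adj_eq_0:
  assumes "A ** adj A = 0" shows "A = 0"
proof -
  have "adj A *v v = 0" for v
    using norm_matrix_vector_sq[of "adj A" v] assms by simp
  then have "adj A = 0" by (simp add: matrix_eq)
  then have "adj (adj A) = adj 0" by simp
  then show ?thesis by (simp add: vec_eq_iff)
qed

lemma adj_unitary_conj: "adj (U ** A ** adj U) = U ** adj A ** adj U"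
  by (simp add: adj_mult matrix_mul_assoc)

lemma matrix_vector_axis: "(A *v axis k 1) $ i = A $ i $ k" for A :: "'i::finite operator"
  by (simp add: matrix_vector_mult_def axis_def if_distrib cong: if_cong)

lemma unitary_op_vec_cancel: "unitary_op U \<Longrightarrow> adj U *v (U *v v) = v"
  by (simp add: matrix_vector_mul_assoc unitary_op_def)

lemma Re_trace_mult: "Re (trace (A ** B)) = (\<Sum>k\<in>UNIV. (adj A *v axis k 1) \<bullet> (B *v axis k 1))"
  by (simp add: trace_def matrix_matrix_mult_def matrix_vector_axis inner_complex_vec)

lemma op_sqrt_psd:
  assumes "psd M"
  shows "adj (op_sqrt M) = op_sqrt M" "op_sqrt M ** op_sqrt M = M"
proof -
  obtain U d where U: "unitary_op U" "M = U ** diag_op d ** adj U" "\<And>i. 0 \<le> d i"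
    by (rule psd_decomposition[OF assms]) (rule that)
  have S: "op_sqrt M = U ** diag_op (\<lambda>i. sqrt (d i)) ** adj U"
    unfolding op_sqrt_def by (rule op_fun_eq[OF U(1,2)])
  show "adj (op_sqrt M) = op_sqrt M" by (simp add: S adj_unitary_conj)
  show "op_sqrt M ** op_sqrt M = M"
    unfolding S unitary_conj_mult[OF U(1)] diag_op_mult using U(3) by (simp add: U(2)[symmetric])
qed

text \<open>One half of the duality between trace norm and operator norm. In the eigenbasis of
  \<open>adj M ** M\<close> the vector \<open>M *v x k\<close> has norm \<open>sqrt (s k)\<close>,
  and Cauchy-Schwarz bounds each diagonal term.\<close>

lemma trace_op_abs_ge:
  assumes W: "\<And>v. norm (adj W *v v) \<le> norm v"
  shows "Re (trace (M ** W)) \<le> Re (trace (op_abs M))"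
proof -
  have "psd (adj M ** M)" using psd_mult_adj[of "adj M"] by simp
  then obtain X s where X: "unitary_op X" "adj M ** M = X ** diag_op s ** adj X" "\<And>i. 0 \<le> s i"
    by (rule psd_decomposition) (rule that)
  have "op_abs M = X ** diag_op (\<lambda>i. sqrt (s i)) ** adj X"
    unfolding op_abs_def op_sqrt_def by (rule op_fun_eq[OF X(1,2)])
  then have abs: "Re (trace (op_abs M)) = (\<Sum>k\<in>UNIV. sqrt (s k))"
    using X(1) by (simp add: trace_unitary_conj trace_diag_op)
  define x where "x k = X *v axis k 1" for k
  have nx: "norm (x k) = 1" for k
    by (simp add: x_def norm_unitary_op[OF X(1)])
  have nM: "norm (M *v x k) = sqrt (s k)" for k
  proof -
    have "(norm (M *v x k))\<^sup>2 = (X *v axis k 1) \<bullet> (X *v (diag_op s *v axis k 1))"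
      unfolding norm_matrix_vector_sq X(2) x_def
      using X(1) by (simp add: matrix_vector_mul_assoc[symmetric] unitary_op_vec_cancel)
    also have "\<dots> = axis k 1 \<bullet> (diag_op s *v axis k 1)"
      using X(1) by (simp add: inner_adj[of _ X] unitary_op_vec_cancel)
    also have "\<dots> = (\<Sum>i\<in>UNIV. s i * (if i = k then 1 else 0))"
      unfolding inner_diag_op by (rule sum.cong) (auto simp: axis_def)
    finally show ?thesis
      by (simp add: if_distrib real_sqrt_unique cong: if_cong)
  qed
  have "trace (M ** W) = trace (adj X ** W ** (M ** X))"
  proof -
    have "trace (adj X ** W ** (M ** X)) = trace (M ** X ** (adj X ** W))"
      by (rule trace_mul_sym)
    also have "M ** X ** (adj X ** W) = M ** W"
      using X(1) by (simp add: matrix_mul_assoc unitary_cancel)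
    finally show ?thesis by simp
  qed
  also have "Re \<dots> = (\<Sum>k\<in>UNIV. (adj W *v x k) \<bullet> (M *v x k))"
    by (simp add: Re_trace_mult adj_mult x_def matrix_vector_mul_assoc)
  also have "\<dots> \<le> (\<Sum>k\<in>UNIV. sqrt (s k))"
  proof (rule sum_mono)
    fix k
    have "(adj W *v x k) \<bullet> (M *v x k) \<le> norm (adj W *v x k) * norm (M *v x k)"
      by (rule norm_cauchy_schwarz)
    also have "\<dots> \<le> 1 * sqrt (s k)"
      using W[of "x k"] X(3)[of k] by (intro mult_mono) (simp_all add: nx nM)
    finally show "(adj W *v x k) \<bullet> (M *v x k) \<le> sqrt (s k)" by simp
  qed
  finally show ?thesis by (simp add: abs)
qed

text \<open>If \<open>\<tau> = Y \<rho> Y\<^sup>\<dagger>\<close>, then \<open>Y \<surd>\<rho> = \<surd>\<tau> W\<close> for a contraction \<open>W\<close>; it is the pseudoinverse of \<open>\<surd>\<tau>\<close>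
  times \<open>Y \<surd>\<rho>\<close>, where \<open>1 / sqrt 0 = 0\<close> inverts \<open>\<surd>\<tau>\<close> on its range only.\<close>

lemma fidelity_congruence_ge:
  assumes \<rho>: "psd \<rho>"
  shows "Re (trace (Y ** \<rho>)) \<le> fidelity \<rho> (Y ** \<rho> ** adj Y)"
proof -
  define S where "S = op_sqrt \<rho>"
  have S: "adj S = S" "S ** S = \<rho>" using op_sqrt_psd[OF \<rho>] by (simp_all add: S_def)
  define \<tau> where "\<tau> = Y ** \<rho> ** adj Y"
  have "psd \<tau>" unfolding \<tau>_def by (rule psd_congruence[OF \<rho>])
  then obtain V t where V: "unitary_op V" "\<tau> = V ** diag_op t ** adj V" "\<And>i. 0 \<le> t i"
    by (rule psd_decomposition) (rule that)
  have \<tau>: "\<tau> = Y ** S ** adj (Y ** S)"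
    by (simp add: \<tau>_def adj_mult S(1) matrix_mul_assoc) (simp add: matrix_mul_assoc[symmetric] S(2))
  define P where "P = V ** diag_op (\<lambda>i. if t i = 0 then 0 else 1) ** adj V"
  define Q where "Q = V ** diag_op (\<lambda>i. 1 / sqrt (t i)) ** adj V"
  define W where "W = Q ** (Y ** S)"
  have T: "op_sqrt \<tau> = V ** diag_op (\<lambda>i. sqrt (t i)) ** adj V"
    unfolding op_sqrt_def by (rule op_fun_eq[OF V(1,2)])
  have adjs: "adj P = P" "adj Q = Q"
    by (simp_all add: P_def Q_def adj_unitary_conj)
  have TQ: "op_sqrt \<tau> ** Q = P"
  proof -
    have "(\<lambda>i. sqrt (t i) * (1 / sqrt (t i))) = (\<lambda>i. if t i = 0 then 0 else 1)"
      by (rule ext) simp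
    then show ?thesis unfolding T Q_def P_def unitary_conj_mult[OF V(1)] diag_op_mult by simp
  qed
  have QQ: "Q ** \<tau> ** Q = P"
  proof -
    have "(\<lambda>i. (1 / sqrt (t i)) * t i * (1 / sqrt (t i))) = (\<lambda>i. if t i = 0 then 0 else 1)"
      using V(3) by (intro ext) (simp add: field_simps)
    then show ?thesis unfolding V(2) Q_def P_def unitary_conj_mult[OF V(1)] diag_op_mult by simp
  qed
  \<comment> \<open>\<open>P\<close> projects onto the range of \<open>\<tau>\<close>. As
    \<open>(mat 1 - P) ** \<tau> = 0\<close>, the product of \<open>(mat 1 - P) ** (Y ** S)\<close>
    with its adjoint vanishes, hence so does the matrix itself.\<close>
  have P1: "P ** (Y ** S) = Y ** S"
  proof -
    have "P ** \<tau> = \<tau>"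
    proof -
      have "(\<lambda>i. (if t i = 0 then 0 else 1) * t i) = t" by (rule ext) simp
      then show ?thesis unfolding V(2) P_def unitary_conj_mult[OF V(1)] diag_op_mult by simp
    qed
    then have "(mat 1 - P) ** \<tau> = 0"
      by (simp add: matrix_diff_distrib)
    moreover have "(mat 1 - P) ** (Y ** S) ** adj ((mat 1 - P) ** (Y ** S)) = (mat 1 - P) ** \<tau> ** adj (mat 1 - P)"
      unfolding \<tau> adj_mult[of "mat 1 - P"] by (simp only: matrix_mul_assoc)
    ultimately have "(mat 1 - P) ** (Y ** S) ** adj ((mat 1 - P) ** (Y ** S)) = 0"
      by (simp only: matrix_mult_zero)
    then have "(mat 1 - P) ** (Y ** S) = 0"
      by (rule mult_adj_eq_0)
    then show ?thesis by (simp add: matrix_diff_distrib)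
  qed
  \<comment> \<open>\<open>W ** adj W\<close> is the projection \<open>P\<close>, so
    \<open>adj W\<close> does not increase norms.\<close>
  have "norm (adj W *v v) \<le> norm v" for v
  proof -
    have "W ** adj W = P"
      using QQ unfolding \<tau> W_def adj_mult[of Q] adjs by (simp only: matrix_mul_assoc)
    then have "(norm (adj W *v v))\<^sup>2 = v \<bullet> (P *v v)"
      using norm_matrix_vector_sq[of "adj W" v] by simp
    also have "\<dots> = (adj V *v v) \<bullet> (diag_op (\<lambda>i. if t i = 0 then 0 else 1) *v (adj V *v v))"
      unfolding P_def by (simp add: inner_adj[of _ V] matrix_vector_mul_assoc[symmetric])
    also have "\<dots> \<le> (adj V *v v) \<bullet> (diag_op (\<lambda>i. 1) *v (adj V *v v))"
      unfolding inner_diag_op by (intro sum_mono mult_right_mono) auto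
    also have "\<dots> = (norm v)\<^sup>2"
      using norm_unitary_op[OF unitary_op_adj[OF V(1)], of v] by (simp add: diag_op_one dot_square_norm)
    finally show ?thesis by (simp add: power2_le_iff_abs_le)
  qed
  from trace_op_abs_ge[OF this, where M = "S ** op_sqrt \<tau>"]
  have "Re (trace (S ** (op_sqrt \<tau> ** W))) \<le> fidelity \<rho> \<tau>"
    by (simp add: fidelity_def S_def matrix_mul_assoc)
  also have "op_sqrt \<tau> ** W = Y ** S"
    using P1 TQ by (simp add: W_def matrix_mul_assoc)
  also have "trace (S ** (Y ** S)) = trace (Y ** \<rho>)"
    by (subst trace_mul_sym) (simp add: matrix_mul_assoc[symmetric] S(2))
  finally show ?thesis by (simp add: \<tau>_def)
qed

section \<open>Smoothing\<close>

lemma diag_op_matrix_vector: "(diag_op d *v v) $ i = of_real (d i) * v $ i"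
  by (simp add: matrix_vector_mult_def diag_op_nth if_distrib if_distribR cong: if_cong)

text \<open>With \<open>L = diag l\<close> and \<open>R = diag r\<close>, \<open>K\<close> solves \<open>L K + K R = \<surd>L C \<surd>R\<close>. Testing this equation
  on an eigenvector \<open>x\<close> of \<open>K K\<^sup>\<dagger>\<close> with eigenvalue \<open>m\<close> and on \<open>y = K\<^sup>\<dagger> x\<close> gives
  \<open>m a\<^sup>2 + b\<^sup>2 \<le> a b\<close> with \<open>a = |\<surd>L x|\<close> and \<open>b = |\<surd>R y|\<close>.\<close>

lemma sylvester_contraction:
  assumes C: "unitary_op C" and l: "\<And>j. 0 \<le> l j" and r: "\<And>i. 0 \<le> r i"
  defines "K \<equiv> (\<chi> j i. C $ j $ i * of_real (sqrt (l j) * sqrt (r i) / (l j + r i)))"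
  shows "psd (mat 1 - K ** adj K)"
proof -
  obtain X m where X: "unitary_op X" "K ** adj K = X ** diag_op m ** adj X" "\<And>i. 0 \<le> m i"
    by (rule psd_decomposition[OF psd_mult_adj[of K]]) (rule that)
  have m: "m k \<le> 1" for k
  proof (rule ccontr)
    assume m1: "\<not> m k \<le> 1"
    define x where "x = X *v axis k 1"
    define y where "y = adj K *v x"
    have "diag_op m *v axis k 1 = m k *\<^sub>R axis k 1"
      by (simp add: vec_eq_iff diag_op_matrix_vector axis_def scaleR_conv_of_real[where 'a=complex])
    moreover have "K *v y = (X ** diag_op m ** adj X) *v (X *v axis k 1)"
      by (simp add: y_def x_def matrix_vector_mul_assoc matrix_mul_assoc X(2)[symmetric])
    ultimately have "K *v y = X *v (m k *\<^sub>R axis k 1)"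
      using X(1) by (simp add: matrix_vector_mul_assoc[symmetric] unitary_op_vec_cancel)
    then have Ky: "K *v y = m k *\<^sub>R x"
      by (simp add: x_def linear_cmul[OF linear_matrix_vector_complex])
    have nx: "norm x = 1" by (simp add: x_def norm_unitary_op[OF X(1)])
    define a where "a = norm (diag_op (\<lambda>j. sqrt (l j)) *v x)"
    define b where "b = norm (diag_op (\<lambda>i. sqrt (r i)) *v y)"
    have a2: "a\<^sup>2 = x \<bullet> (diag_op l *v x)" and b2: "b\<^sup>2 = y \<bullet> (diag_op r *v y)"
      using l r by (simp_all add: a_def b_def norm_matrix_vector_sq diag_op_mult)
    have syl: "diag_op l ** K + K ** diag_op r = diag_op (\<lambda>j. sqrt (l j)) ** C ** diag_op (\<lambda>i. sqrt (r i))"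
    proof -
      have "of_real (l j) * K $ j $ i + K $ j $ i * of_real (r i)
          = of_real (sqrt (l j)) * C $ j $ i * of_real (sqrt (r i))" for i j
      proof (cases "l j + r i = 0")
        \<comment> \<open>Both eigenvalues vanish; the entry of \<open>K\<close> is a quotient by
          zero, hence zero, which agrees with the right-hand side.\<close>
        case True
        then have "l j = 0" "r i = 0" using l[of j] r[of i] by linarith+
        then show ?thesis by simp
      next
        case False
        have "of_real (l j) * K $ j $ i + K $ j $ i * of_real (r i)
            = C $ j $ i * of_real ((l j + r i) * (sqrt (l j) * sqrt (r i) / (l j + r i)))"
          by (simp add: K_def algebra_simps del: times_divide_eq_right times_divide_eq_left)
        also have "(l j + r i) * (sqrt (l j) * sqrt (r i) / (l j + r i)) = sqrt (l j) * sqrt (r i)"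
          using False by simp
        finally show ?thesis by simp
      qed
      then show ?thesis by (simp add: vec_eq_iff mult_diag_op_nth diag_op_mult_nth)
    qed
    have "x \<bullet> (diag_op l *v (K *v y)) = m k * a\<^sup>2"
      by (simp only: Ky a2 linear_cmul[OF linear_matrix_vector_complex] inner_scaleR_right)
    moreover have "x \<bullet> (K *v (diag_op r *v y)) = b\<^sup>2"
      by (simp only: inner_adj[of x K] y_def[symmetric] b2)
    ultimately have "m k * a\<^sup>2 + b\<^sup>2 = x \<bullet> (diag_op l *v (K *v y)) + x \<bullet> (K *v (diag_op r *v y))"
      by simp
    also have "\<dots> = x \<bullet> ((diag_op l ** K + K ** diag_op r) *v y)"
      by (simp add: matrix_vector_mul_assoc matrix_vector_mult_add_rdistrib inner_add_right)
    also have "\<dots> = (diag_op (\<lambda>j. sqrt (l j)) *v x) \<bullet> (C *v (diag_op (\<lambda>i. sqrt (r i)) *v y))"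
      unfolding syl by (simp add: matrix_vector_mul_assoc[symmetric] inner_adj[of x])
    also have "\<dots> \<le> a * b"
      unfolding a_def b_def by (metis norm_cauchy_schwarz norm_unitary_op[OF C])
    finally have le: "m k * a\<^sup>2 + b\<^sup>2 \<le> a * b" .
    \<comment> \<open>For \<open>m k > 1\<close>, the bound \<open>le\<close> and the
      arithmetic-geometric mean inequality leave only \<open>a = 0\<close>. Then \<open>x\<close>
      vanishes wherever \<open>l\<close> is positive, while the rows of \<open>K\<close> vanish
      wherever \<open>l\<close> is zero; so \<open>y = 0\<close>, against \<open>Ky\<close>.\<close>
    have "a\<^sup>2 \<le> m k * a\<^sup>2" using m1 mult_right_mono[of 1 "m k" "a\<^sup>2"] by simp
    moreover have "2 * (a * b) \<le> a\<^sup>2 + b\<^sup>2" using sum_squares_bound[of a b] by simp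
    ultimately have "a\<^sup>2 + b\<^sup>2 \<le> 0" using le by linarith
    then have "a = 0" by (simp add: sum_power2_le_zero_iff)
    then have sx: "of_real (sqrt (l j)) * x $ j = 0" for j
      using diag_op_matrix_vector[of "\<lambda>j. sqrt (l j)" x j] by (simp add: a_def)
    have "y = 0"
    proof -
      have "(\<Sum>j\<in>UNIV. cnj (K $ j $ i) * x $ j) = 0" for i
        by (rule sum.neutral) (use sx in \<open>auto simp: K_def\<close>)
      then show ?thesis by (simp add: vec_eq_iff y_def matrix_vector_mult_def)
    qed
    then have "m k *\<^sub>R x = 0" using Ky by (simp add: linear_0[OF linear_matrix_vector_complex])
    then show False using nx m1 by auto
  qed
  have "mat 1 = X ** diag_op (\<lambda>i. 1) ** adj X"
    using X(1) by (simp add: diag_op_one unitary_op_def)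
  then have "mat 1 - K ** adj K = X ** diag_op (\<lambda>i. 1 - m i) ** adj X"
    unfolding X(2) diag_op_diff[symmetric] matrix_diff_distrib by simp
  also have "psd \<dots>" by (intro psd_congruence psd_diag_op) (simp add: m)
  finally show ?thesis .
qed

lemma unitary_op_row_norm:
  assumes "unitary_op U"
  shows "(\<Sum>j\<in>UNIV. (cmod (U $ j $ i))\<^sup>2) = 1" "(\<Sum>i\<in>UNIV. (cmod (U $ j $ i))\<^sup>2) = 1"
proof -
  have sq: "cnj z * z = of_real ((cmod z)\<^sup>2)" "z * cnj z = of_real ((cmod z)\<^sup>2)" for z
    using complex_norm_square[of z] by (simp_all add: mult.commute)
  have "(adj U ** U) $ i $ i = 1" "(U ** adj U) $ j $ j = 1"
    using assms by (simp_all add: unitary_op_def mat_def)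
  then have "of_real (\<Sum>j\<in>UNIV. (cmod (U $ j $ i))\<^sup>2) = (1::complex)"
    "of_real (\<Sum>i\<in>UNIV. (cmod (U $ j $ i))\<^sup>2) = (1::complex)"
    by (simp_all add: matrix_matrix_mult_def sq)
  then show "(\<Sum>j\<in>UNIV. (cmod (U $ j $ i))\<^sup>2) = 1" "(\<Sum>i\<in>UNIV. (cmod (U $ j $ i))\<^sup>2) = 1"
    by (simp_all only: of_real_eq_1_iff)
qed

lemma Re_trace_conj_diag:
  "Re (trace (adj A ** diag_op d ** B)) = (\<Sum>i\<in>UNIV. \<Sum>j\<in>UNIV. d j * Re (cnj (A $ j $ i) * B $ j $ i))"
proof -
  have "(adj A ** diag_op d ** B) $ i $ i = (\<Sum>j\<in>UNIV. cnj (A $ j $ i) * of_real (d j) * B $ j $ i)" for i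
    by (simp add: matrix_matrix_mult_def[of "adj A ** diag_op d"] mult_diag_op_nth)
  moreover have "Re (cnj a * of_real x * b) = x * Re (cnj a * b)" for a b x
    by (simp add: algebra_simps)
  ultimately show ?thesis by (simp only: trace_def Re_sum)
qed

text \<open>In the two eigenbases the Sylvester solution \<open>Y\<close> has the matrix
  \<open>G\<close>, the overlaps \<open>C\<close> multiplied entrywise by
  \<open>l / (l + r)\<close>. The operator sought is \<open>Y ** \<rho> ** adj Y\<close>, and
  \<open>fidelity_congruence_ge\<close> reduces its fidelity to the trace of
  \<open>Y ** \<rho>\<close>.\<close>

lemma smoothing:
  fixes U W :: "'i::finite operator" and r l :: "'i \<Rightarrow> real"
  assumes U: "unitary_op U" and W: "unitary_op W" and r: "\<And>i. 0 \<le> r i" and l: "\<And>j. 0 \<le> l j"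
    and r1: "(\<Sum>i\<in>UNIV. r i) \<le> 1"
  defines "\<rho> \<equiv> U ** diag_op r ** adj U" and "C \<equiv> adj W ** U"
  obtains \<tau> where "\<tau> \<in> substates" "psd (W ** diag_op l ** adj W - \<tau>)"
    "fidelity \<rho> \<tau> \<ge> (\<Sum>i\<in>UNIV. \<Sum>j\<in>UNIV. (cmod (C $ j $ i))\<^sup>2 * (r i * (l j / (l j + r i))))"
proof -
  have C: "unitary_op C" unfolding C_def by (intro unitary_op_mult unitary_op_adj U W)
  have \<rho>: "psd \<rho>" unfolding \<rho>_def by (intro psd_congruence psd_diag_op r)
  define G where "G = (\<chi> j i. C $ j $ i * of_real (l j / (l j + r i)))"
  define K where "K = (\<chi> j i. C $ j $ i * of_real (sqrt (l j) * sqrt (r i) / (l j + r i)))"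
  define Y where "Y = W ** G ** adj U"
  define \<tau> where "\<tau> = Y ** \<rho> ** adj Y"
  have \<tau>: "\<tau> = W ** (G ** diag_op r ** adj G) ** adj W"
    using U by (simp add: \<tau>_def Y_def \<rho>_def adj_mult matrix_mul_assoc unitary_cancel)
  \<comment> \<open>This turns \<open>G ** diag_op r ** adj G\<close> into a congruence of
    \<open>K ** adj K\<close>, so \<open>sylvester_contraction\<close> gives the domination.\<close>
  have "diag_op (\<lambda>j. sqrt (l j)) ** K = G ** diag_op (\<lambda>i. sqrt (r i))"
    using l by (simp add: vec_eq_iff diag_op_mult_nth mult_diag_op_nth K_def G_def
        of_real_mult[symmetric] mult.assoc mult.left_commute[of _ "C $ _ $ _"] del: of_real_mult)
  have "G ** diag_op r ** adj G = diag_op (\<lambda>j. sqrt (l j)) ** (K ** adj K) ** adj (diag_op (\<lambda>j. sqrt (l j)))"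
  proof -
    have "G ** diag_op r ** adj G = G ** diag_op (\<lambda>i. sqrt (r i)) ** adj (G ** diag_op (\<lambda>i. sqrt (r i)))"
      using r by (simp add: adj_mult matrix_mul_assoc) (simp add: matrix_mul_assoc[symmetric] diag_op_mult)
    also have "\<dots> = diag_op (\<lambda>j. sqrt (l j)) ** K ** adj (diag_op (\<lambda>j. sqrt (l j)) ** K)"
      using \<open>diag_op (\<lambda>j. sqrt (l j)) ** K = _\<close> by simp
    finally show ?thesis by (simp add: adj_mult matrix_mul_assoc)
  qed
  moreover have "diag_op l = diag_op (\<lambda>j. sqrt (l j)) ** mat 1 ** adj (diag_op (\<lambda>j. sqrt (l j)))"
    using l by (simp add: diag_op_mult)
  ultimately have "diag_op l - G ** diag_op r ** adj G =
      diag_op (\<lambda>j. sqrt (l j)) ** (mat 1 - K ** adj K) ** adj (diag_op (\<lambda>j. sqrt (l j)))"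
    by (simp add: matrix_diff_distrib)
  also have "psd \<dots>"
    unfolding K_def by (intro psd_congruence sylvester_contraction C l r)
  finally have "psd (W ** (diag_op l - G ** diag_op r ** adj G) ** adj W)"
    by (rule psd_congruence)
  then have le: "psd (W ** diag_op l ** adj W - \<tau>)"
    by (simp add: \<tau> matrix_diff_distrib)
  \<comment> \<open>The multiplier lies between 0 and 1 and the columns of \<open>C\<close> are unit
    vectors, so the trace of \<open>\<tau>\<close> is at most the sum of \<open>r\<close>.\<close>
  have "trace \<tau> = trace (adj (adj G) ** diag_op r ** adj G)"
    unfolding \<tau> by (simp add: trace_unitary_conj W)
  then have "Re (trace \<tau>) = (\<Sum>j\<in>UNIV. \<Sum>i\<in>UNIV. r i * Re (G $ j $ i * cnj (G $ j $ i)))"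
    by (simp only: Re_trace_conj_diag adj_nth complex_cnj_cnj)
  also have "\<dots> \<le> (\<Sum>j\<in>UNIV. \<Sum>i\<in>UNIV. r i * (cmod (C $ j $ i))\<^sup>2)"
  proof (intro sum_mono mult_left_mono r)
    fix i j
    have "l j / (l j + r i) \<le> 1" "0 \<le> l j / (l j + r i)"
      using l[of j] r[of i] by (auto simp: divide_le_eq_1)
    then have "cmod (G $ j $ i) \<le> cmod (C $ j $ i)"
    proof -
      have "cmod (G $ j $ i) = cmod (C $ j $ i) * \<bar>l j / (l j + r i)\<bar>"
        by (simp only: G_def vec_lambda_beta norm_mult norm_of_real)
      with \<open>l j / (l j + r i) \<le> 1\<close> \<open>0 \<le> l j / (l j + r i)\<close> show ?thesis
        using mult_left_mono[of "l j / (l j + r i)" 1 "cmod (C $ j $ i)"] by (simp only: abs_of_nonneg mult_1_right norm_ge_zero)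
    qed
    then have "(cmod (G $ j $ i))\<^sup>2 \<le> (cmod (C $ j $ i))\<^sup>2" by simp
    then show "Re (G $ j $ i * cnj (G $ j $ i)) \<le> (cmod (C $ j $ i))\<^sup>2"
      by (metis complex_norm_square Re_complex_of_real)
  qed
  also have "\<dots> = (\<Sum>i\<in>UNIV. r i)"
    by (subst sum.swap) (simp add: sum_distrib_left[symmetric] unitary_op_row_norm[OF C])
  finally have "\<tau> \<in> substates"
    using r1 psd_congruence[OF \<rho>, of Y] by (simp add: substates_def \<tau>_def)
  moreover note le
  moreover have "fidelity \<rho> \<tau> \<ge> (\<Sum>i\<in>UNIV. \<Sum>j\<in>UNIV. (cmod (C $ j $ i))\<^sup>2 * (r i * (l j / (l j + r i))))"
  proof -
    have "trace (Y ** \<rho>) = trace (W ** (G ** diag_op r ** adj U))"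
      using U by (simp add: Y_def \<rho>_def matrix_mul_assoc unitary_cancel)
    also have "\<dots> = trace (G ** diag_op r ** (adj U ** W))"
      by (subst trace_mul_sym) (simp add: matrix_mul_assoc)
    also have "\<dots> = trace (adj (adj G) ** diag_op r ** adj C)"
      by (simp add: C_def adj_mult)
    finally have "Re (trace (Y ** \<rho>)) = (\<Sum>j\<in>UNIV. \<Sum>i\<in>UNIV. r i * Re (G $ j $ i * cnj (C $ j $ i)))"
      by (simp only: Re_trace_conj_diag adj_nth complex_cnj_cnj)
    also have "\<dots> = (\<Sum>j\<in>UNIV. \<Sum>i\<in>UNIV. (cmod (C $ j $ i))\<^sup>2 * (r i * (l j / (l j + r i))))"
    proof (intro sum.cong refl)
      fix i j
      have "G $ j $ i * cnj (C $ j $ i) = of_real ((cmod (C $ j $ i))\<^sup>2 * (l j / (l j + r i)))"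
        by (simp only: G_def vec_lambda_beta of_real_mult complex_norm_square mult_ac)
      then show "r i * Re (G $ j $ i * cnj (C $ j $ i)) = (cmod (C $ j $ i))\<^sup>2 * (r i * (l j / (l j + r i)))"
        by simp
    qed
    finally show ?thesis
      using fidelity_congruence_ge[OF \<rho>, of Y] by (subst sum.swap) (simp add: \<tau>_def)
  qed
  ultimately show thesis by (rule that)
qed

section \<open>The exponential moment of the log-likelihood ratio\<close>

text \<open>The logarithm of \<open>(1 + a) / (1 - a)\<close> is convex on [0, 1/2] and so lies
  below its chord, which runs from 0 to \<open>ln 3\<close>. Equality at \<open>a = 1/2\<close>
  accounts for the threshold 3 in the concavity statement that follows.\<close>

lemma ratio_le_powr_9:
  fixes a :: real
  assumes "0 < a" "a \<le> 1/2"
  shows "1 + a \<le> (1 - a) * 9 powr a"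
proof -
  define f where "f = (\<lambda>x::real. ln (1 + x) - ln (1 - x))"
  have "convex_on {0..1/2} f"
  proof (rule f''_ge0_imp_convex)
    show "(f has_real_derivative (1 / (1 + x) + 1 / (1 - x))) (at x)" if "x \<in> {0..1/2}" for x
      unfolding f_def using that by (auto intro!: derivative_eq_intros simp: field_simps)
    show "((\<lambda>x. 1 / (1 + x) + 1 / (1 - x)) has_real_derivative (1 / (1 - x)\<^sup>2 - 1 / (1 + x)\<^sup>2)) (at x)"
      if "x \<in> {0..1/2}" for x
      using that by (auto intro!: derivative_eq_intros simp: power2_eq_square)
    show "0 \<le> 1 / (1 - x)\<^sup>2 - 1 / (1 + x)\<^sup>2" if "x \<in> {0..1/2}" for x :: real
    proof -
      have "(1 - x)\<^sup>2 \<le> (1 + x)\<^sup>2" using that by (intro power_mono) auto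
      then show ?thesis using that by (simp add: frac_le)
    qed
  qed auto
  then have "f ((1 - 2 * a) *\<^sub>R 0 + (2 * a) *\<^sub>R (1/2)) \<le> (1 - 2 * a) * f 0 + 2 * a * f (1/2)"
    using assms by (intro convex_onD) auto
  then have "f a \<le> 2 * a * f (1/2)" by (simp add: f_def)
  also have "f (1/2) = ln ((3/2) / (1/2))"
    unfolding f_def by (subst ln_div) auto
  finally have "f a \<le> 2 * a * ln 3" by simp
  also have "2 * a * ln 3 = ln (9 powr a)"
    using ln_realpow[of 3 2] by (simp add: ln_powr)
  finally have "ln (1 + a) \<le> ln ((1 - a) * 9 powr a)"
    using assms by (simp add: f_def ln_mult)
  then show ?thesis using assms by (subst (asm) ln_le_cancel_iff) auto
qed

text \<open>The sign of the second derivative comes down to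
  \<open>1 + a \<le> (1 - a) * z powr (2 * a)\<close>, whose right-hand side increases with
  \<open>z\<close>.\<close>

lemma concave_powr_add_powr_minus:
  fixes a :: real
  assumes "0 < a" "a \<le> 1/2"
  shows "concave_on {3..} (\<lambda>z. z powr a + z powr (- a))"
  unfolding concave_on_def
proof (rule f''_ge0_imp_convex)
  fix z :: real assume z: "z \<in> {3..}"
  show "((\<lambda>z. - (z powr a + z powr - a)) has_real_derivative (- (a * z powr (a - 1)) + a * z powr (- a - 1))) (at z)"
    using z by (auto intro!: derivative_eq_intros)
  show "((\<lambda>z. - (a * z powr (a - 1)) + a * z powr (- a - 1)) has_real_derivative
      (a * (1 - a) * z powr (a - 2) - a * (a + 1) * z powr (- a - 2))) (at z)"
    using z by (auto intro!: derivative_eq_intros simp: algebra_simps)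
  have "1 + a \<le> (1 - a) * 9 powr a" by (rule ratio_le_powr_9[OF assms])
  also have "9 powr a = 3 powr (2 * a)" by (simp add: powr_powr[symmetric])
  also have "3 powr (2 * a) \<le> z powr (2 * a)" using z assms by (intro powr_mono2) auto
  finally have "1 + a \<le> (1 - a) * z powr (2 * a)" using assms by (auto intro: mult_left_mono)
  then have "(1 + a) * z powr (- a - 2) \<le> (1 - a) * z powr (2 * a) * z powr (- a - 2)"
    by (intro mult_right_mono) auto
  also have "\<dots> = (1 - a) * z powr (a - 2)" by (simp add: powr_add[symmetric])
  finally have "a * ((1 + a) * z powr (- a - 2)) \<le> a * ((1 - a) * z powr (a - 2))"
    using assms by (intro mult_left_mono) auto
  then show "0 \<le> a * (1 - a) * z powr (a - 2) - a * (a + 1) * z powr (- a - 2)"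
    by (simp add: algebra_simps)
qed auto

text \<open>Odd Taylor terms cancel, and the fourth-order remainder is at most
  \<open>v ^ 4 / 4\<close>. Since \<open>v\<close> is at most 3/5, the total is below
  \<open>5/4 * v\<^sup>2\<close>, and 5/4 is less than \<open>1 / ln 2\<close>.\<close>

lemma exp_symmetric_bound:
  fixes v :: real
  assumes "0 \<le> v" "v \<le> ln 3 / 2"
  shows "exp v + exp (- v) - 2 \<le> v\<^sup>2 / ln 2"
proof -
  have "ln 3 \<le> (6/5::real)"
  proof -
    \<comment> \<open>The sixth power of 61/50 exceeds 3, which gives
      \<open>ln 3 \<le> 6/5\<close>.\<close>
    have "(1::real) + 1/5 + (1/5)\<^sup>2 / 2 \<le> exp (1/5)" by (rule exp_lower_Taylor_quadratic) simp
    then have "(61/50::real) \<le> exp (1/5)" by (simp add: power2_eq_square)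
    then have "(61/50::real) ^ 6 \<le> exp (1/5) ^ 6" by (rule power_mono) simp
    also have "exp (1/5::real) ^ 6 = exp (6/5)" by (simp add: exp_of_nat_mult[symmetric])
    finally have "(3::real) \<le> exp (6/5)" by (simp add: power_numeral_reduce)
    then have "ln 3 \<le> ln (exp (6/5::real))" by (subst ln_le_cancel_iff) auto
    then show ?thesis by simp
  qed
  then have v: "v \<le> 3/5" using assms by simp
  obtain t where t: "\<bar>t\<bar> \<le> \<bar>v\<bar>" "exp v = (\<Sum>m<4. v ^ m / fact m) + exp t / fact 4 * v ^ 4"
    using Maclaurin_exp_le[of v 4] by blast
  obtain s where s: "\<bar>s\<bar> \<le> \<bar>-v\<bar>" "exp (-v) = (\<Sum>m<4. (-v) ^ m / fact m) + exp s / fact 4 * (-v) ^ 4"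
    using Maclaurin_exp_le[of "-v" 4] by blast
  have "exp t \<le> 3" "exp s \<le> 3"
    using t(1) s(1) v assms exp_le exp_le_cancel_iff[of t 1] exp_le_cancel_iff[of s 1] by linarith+
  then have st: "exp t * v ^ 4 \<le> 3 * v ^ 4" "exp s * v ^ 4 \<le> 3 * v ^ 4"
    by (intro mult_right_mono; simp)+
  have "exp v + exp (- v) - 2 = v\<^sup>2 + (exp t * v ^ 4 + exp s * v ^ 4) / 24"
    unfolding t(2) s(2) by (simp add: eval_nat_numeral field_simps)
  also have "\<dots> \<le> v\<^sup>2 + v\<^sup>2 * v\<^sup>2 / 4" using st by (simp add: eval_nat_numeral)
  also have "v\<^sup>2 * v\<^sup>2 \<le> v\<^sup>2 * 1"
    using v assms by (intro mult_left_mono) (auto simp: power_le_one_iff)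
  finally have "exp v + exp (- v) - 2 \<le> v\<^sup>2 * (5/4)" by simp
  also have "5/4 \<le> 1 / ln (2::real)" using ln2_le_25_over_36 by (simp add: field_simps)
  finally show ?thesis by (auto simp: mult_left_mono)
qed

lemma add_inverse_mono:
  fixes u v :: real
  assumes "1 \<le> u" "u \<le> v"
  shows "u + 1 / u \<le> v + 1 / v"
proof -
  have "u * v \<ge> 1" using assms mult_mono[of 1 u 1 v] by simp
  then have "0 \<le> (v - u) * (u * v - 1) / (u * v)" using assms by simp
  also have "\<dots> = v + 1 / v - (u + 1 / u)" using assms by (simp add: field_simps)
  finally show ?thesis by simp
qed

text \<open>The left-hand side is unchanged under inversion of \<open>x\<close>, so it may be
  evaluated at whichever of \<open>sqrt x\<close> and \<open>1 / sqrt x\<close> is at least 1;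
  \<open>z\<close> exceeds both. The summand 1 in \<open>z\<close> also moves it into [3,
  \<infinity>), where concavity is available.\<close>

lemma powr_symmetric_bound:
  fixes x t :: real
  assumes x: "0 < x" and t: "0 < t"
  defines "z \<equiv> sqrt x + 1 / sqrt x + 1"
  shows "x powr t + x powr (- t) \<le> z powr (2 * t) + z powr (- (2 * t))"
proof -
  have key: "y powr (2 * t) + y powr (- (2 * t)) \<le> z powr (2 * t) + z powr (- (2 * t))"
    if "1 \<le> y" "y \<le> z" for y
  proof -
    have "1 \<le> y powr (2 * t)" "y powr (2 * t) \<le> z powr (2 * t)"
      using that t by (auto intro!: ge_one_powr_ge_zero powr_mono2)
    from add_inverse_mono[OF this] show ?thesis
      using that by (simp add: powr_minus_divide)
  qed
  have sq: "sqrt x powr (2 * t) = x powr t" "sqrt x powr (- (2 * t)) = x powr (- t)"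
    using x by (simp_all add: powr_half_sqrt[symmetric] powr_powr)
  show ?thesis
  proof (cases "x \<ge> 1")
    case True
    then show ?thesis using key[of "sqrt x"] sq by (simp add: z_def)
  next
    case False
    have "(1 / sqrt x) powr (2 * t) = x powr (- t)" "(1 / sqrt x) powr (- (2 * t)) = x powr t"
      using x sq by (simp_all add: powr_divide powr_minus_divide)
    then show ?thesis using key[of "1 / sqrt x"] False x by (simp add: z_def)
  qed
qed

lemma sqrt_add_inverse_ge_2: "2 \<le> sqrt x + 1 / sqrt x" if "0 < x"
proof -
  have "0 \<le> (sqrt x - 1)\<^sup>2 / sqrt x" using that by simp
  also have "\<dots> = sqrt x + 1 / sqrt x - 2"
    using that by (simp add: field_simps power2_eq_square)
  finally show ?thesis by simp
qed

lemma sqrt_moments_ge_3: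
  fixes p x :: "'i \<Rightarrow> real"
  assumes p: "\<And>i. i \<in> I \<Longrightarrow> 0 \<le> p i" "(\<Sum>i\<in>I. p i) = 1"
    and x: "\<And>i. i \<in> I \<Longrightarrow> 0 < x i"
  shows "3 \<le> (\<Sum>i\<in>I. p i * sqrt (x i)) + (\<Sum>i\<in>I. p i * (1 / sqrt (x i))) + 1"
proof -
  have "(\<Sum>i\<in>I. p i * 2) \<le> (\<Sum>i\<in>I. p i * (sqrt (x i) + 1 / sqrt (x i)))"
    by (intro sum_mono mult_left_mono sqrt_add_inverse_ge_2 p x)
  then show ?thesis
    using p(2) by (simp add: sum_distrib_right[symmetric] distrib_left sum.distrib)
qed

text \<open>From \<open>1 - t * ln x \<le> x powr (- t)\<close> follows
  \<open>x powr t \<le> 1 + t * ln x + (x powr t + x powr (- t) - 2)\<close>. The bracket is at most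
  \<open>g z - 2\<close>; Jensen replaces \<open>z\<close> by its mean \<open>\<eta>\<close>, and
  \<open>exp_symmetric_bound\<close> makes the result quadratic in \<open>t\<close>.\<close>

lemma log_likelihood_moment:
  fixes p x :: "'i \<Rightarrow> real" and t :: real
  assumes fin: "finite I" and p: "\<And>i. i \<in> I \<Longrightarrow> 0 \<le> p i" "(\<Sum>i\<in>I. p i) = 1"
    and x: "\<And>i. i \<in> I \<Longrightarrow> 0 < x i"
  defines "\<eta> \<equiv> (\<Sum>i\<in>I. p i * sqrt (x i)) + (\<Sum>i\<in>I. p i * (1 / sqrt (x i))) + 1"
  assumes t: "0 < t" "4 * t * log 2 \<eta> \<le> log 2 3"
  shows "(\<Sum>i\<in>I. p i * x i powr t) \<le> 2 powr (t * (\<Sum>i\<in>I. p i * log 2 (x i)) + 4 * t\<^sup>2 * (log 2 \<eta>)\<^sup>2)"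
proof -
  define z where "z i = sqrt (x i) + 1 / sqrt (x i) + 1" for i
  have z3: "3 \<le> z i" if "i \<in> I" for i
    using sqrt_add_inverse_ge_2[OF x[OF that]] by (simp add: z_def)
  have \<eta>: "\<eta> = (\<Sum>i\<in>I. p i * z i)"
    unfolding \<eta>_def z_def by (simp add: p(2) distrib_left sum.distrib)
  have \<eta>3: "3 \<le> \<eta>"
    unfolding \<eta>_def by (rule sqrt_moments_ge_3[OF p x])
  have tln: "4 * t * ln \<eta> \<le> ln 3"
    using t(2) by (simp add: log_def divide_le_cancel)
  have "ln 3 \<le> ln \<eta>" using \<eta>3 by simp
  \<comment> \<open>Concavity is used with exponent \<open>2 * t\<close>, which must not exceed
    1/2.\<close>
  have t4: "t \<le> 1/4"
  proof -
    have "4 * t * ln 3 \<le> 4 * t * ln \<eta>" using \<open>ln 3 \<le> ln \<eta>\<close> t(1) by (intro mult_left_mono) auto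
    also note tln
    finally have "4 * t * ln 3 \<le> 1 * ln 3" by simp
    then show ?thesis by (simp only: mult_le_cancel_right) (simp add: ln_gt_zero not_less)
  qed
  define g where "g y = y powr (2 * t) + y powr (- (2 * t))" for y :: real
  have "I \<noteq> {}" using p(2) by auto
  have conc: "concave_on {3..} g"
    unfolding g_def using concave_powr_add_powr_minus[of "2 * t"] t t4 by simp
  have "(\<Sum>i\<in>I. p i * g (z i)) \<le> g (\<Sum>i\<in>I. p i *\<^sub>R z i)"
    by (rule concave_on_sum[OF fin \<open>I \<noteq> {}\<close> conc p(2)]) (use p z3 in auto)
  then have jensen: "(\<Sum>i\<in>I. p i * g (z i)) \<le> g \<eta>" by (simp add: \<eta>)
  have "p i * x i powr t \<le> p i + t * (p i * ln (x i)) + (p i * g (z i) - 2 * p i)" if "i \<in> I" for i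
  proof -
    have "1 - t * ln (x i) \<le> exp (- t * ln (x i))" using exp_ge_add_one_self[of "- t * ln (x i)"] by simp
    also have "\<dots> = x i powr (- t)" using x[OF that] by (simp add: powr_def)
    finally have "x i powr t \<le> 1 + t * ln (x i) + (x i powr t + x i powr (- t) - 2)" by simp
    also have "\<dots> \<le> 1 + t * ln (x i) + (g (z i) - 2)"
      using powr_symmetric_bound[OF x[OF that] t(1)] by (simp add: g_def z_def)
    finally have "p i * x i powr t \<le> p i * (1 + t * ln (x i) + (g (z i) - 2))"
      using p(1)[OF that] by (rule mult_left_mono)
    then show ?thesis by (simp add: algebra_simps)
  qed
  then have "(\<Sum>i\<in>I. p i * x i powr t) \<le> (\<Sum>i\<in>I. p i + t * (p i * ln (x i)) + (p i * g (z i) - 2 * p i))"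
    by (rule sum_mono)
  also have "\<dots> = 1 + t * (\<Sum>i\<in>I. p i * ln (x i)) + ((\<Sum>i\<in>I. p i * g (z i)) - 2)"
    by (simp add: sum.distrib sum_subtractf sum_distrib_left[symmetric] p(2))
  also have "\<dots> \<le> 1 + t * (\<Sum>i\<in>I. p i * ln (x i)) + (g \<eta> - 2)" using jensen by simp
  also have "g \<eta> - 2 \<le> (2 * t * ln \<eta>)\<^sup>2 / ln 2"
    using exp_symmetric_bound[of "2 * t * ln \<eta>"] \<eta>3 t(1) tln by (simp add: g_def powr_def)
  finally have "(\<Sum>i\<in>I. p i * x i powr t) \<le> 1 + (t * (\<Sum>i\<in>I. p i * ln (x i)) + (2 * t * ln \<eta>)\<^sup>2 / ln 2)" by simp
  also have "\<dots> \<le> exp (t * (\<Sum>i\<in>I. p i * ln (x i)) + (2 * t * ln \<eta>)\<^sup>2 / ln 2)"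
    by (rule exp_ge_add_one_self)
  \<comment> \<open>Changing to binary logarithms yields \<open>(ln 2)\<^sup>2\<close> in the
    quadratic term; the division by \<open>ln 2\<close> leaves the single factor that turns
    \<open>exp\<close> into a power of 2.\<close>
  also have "t * (\<Sum>i\<in>I. p i * ln (x i)) + (2 * t * ln \<eta>)\<^sup>2 / ln 2
      = (t * (\<Sum>i\<in>I. p i * log 2 (x i)) + 4 * t\<^sup>2 * (log 2 \<eta>)\<^sup>2) * ln 2"
    by (simp add: log_def sum_divide_distrib[symmetric] power2_eq_square field_simps)
  finally show ?thesis
    by (simp add: powr_def)
qed

section \<open>Tensor products and partial traces\<close>

lemma prod_sum_fun:
  fixes f :: "'k::finite \<Rightarrow> 'i::finite \<Rightarrow> 'c::comm_semiring_1"
  shows "(\<Prod>k\<in>UNIV. \<Sum>y\<in>UNIV. f k y) = (\<Sum>g\<in>UNIV. \<Prod>k\<in>UNIV. f k (g k))"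
  using prod_sum_PiE[of UNIV "\<lambda>_. UNIV" f] by (simp add: PiE_UNIV_domain)

lemma kron_nth [simp]: "kron M N $ p $ q = M $ fst p $ fst q * N $ snd p $ snd q"
  by (simp add: kron_def)

lemma ptrace_A_nth [simp]: "ptrace_A M $ b $ b' = (\<Sum>a\<in>UNIV. M $ (a, b) $ (a, b'))"
  by (simp add: ptrace_A_def)

lemma tensor_power_nth [simp]: "tensor_power M $ x $ y = (\<Prod>k\<in>UNIV. M $ x k $ y k)"
  by (simp add: tensor_power_def)

text \<open>The index bijection behind \<open>regroup\<close>, named so that sums can be reindexed
  along it.\<close>

definition zip_fun :: "('k \<Rightarrow> 'a) \<times> ('k \<Rightarrow> 'b) \<Rightarrow> 'k \<Rightarrow> 'a \<times> 'b" where
  "zip_fun p = (\<lambda>k. (fst p k, snd p k))"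

lemma regroup_nth [simp]: "regroup M $ p $ q = M $ zip_fun p $ zip_fun q"
  by (simp add: regroup_def zip_fun_def)

lemma zip_fun_eq_iff [simp]: "zip_fun p = zip_fun q \<longleftrightarrow> p = q"
  by (auto simp: zip_fun_def fun_eq_iff prod_eq_iff)

lemma bij_zip_fun: "bij (zip_fun :: ('k \<Rightarrow> 'a) \<times> ('k \<Rightarrow> 'b) \<Rightarrow> _)"
proof (rule bijI)
  show "inj zip_fun" by (auto simp: inj_def)
  have "zip_fun (fst \<circ> f, snd \<circ> f) = f" for f :: "'k \<Rightarrow> 'a \<times> 'b"
    by (auto simp: zip_fun_def)
  then show "surj (zip_fun :: ('k \<Rightarrow> 'a) \<times> ('k \<Rightarrow> 'b) \<Rightarrow> _)" by (rule surjI)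
qed

lemma sum_zip_fun: "(\<Sum>p\<in>UNIV. f (zip_fun p)) = (\<Sum>g\<in>UNIV. f g)"
  by (rule sum.reindex_bij_betw[OF bij_zip_fun])

lemma tensor_power_mult: "tensor_power (A ** B) = tensor_power A ** tensor_power B"
  by (simp add: vec_eq_iff matrix_matrix_mult_def prod_sum_fun prod.distrib)

lemma adj_tensor_power: "adj (tensor_power M) = tensor_power (adj M)"
  by (simp add: vec_eq_iff)

lemma tensor_power_diag_op: "tensor_power (diag_op d) = diag_op (\<lambda>x :: 'k::finite \<Rightarrow> 'i::finite. \<Prod>k\<in>UNIV. d (x k))"
proof -
  have "(\<Prod>k\<in>UNIV. if x k = y k then complex_of_real (d (x k)) else 0) =
      (if x = y then of_real (\<Prod>k\<in>UNIV. d (x k)) else 0)" for x y :: "'k \<Rightarrow> 'i"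
    by (auto simp: fun_eq_iff intro!: prod_zero)
  then show ?thesis by (simp add: vec_eq_iff diag_op_nth)
qed

lemma regroup_mult: "regroup (A ** B) = regroup A ** regroup B"
  by (simp add: vec_eq_iff matrix_matrix_mult_def) (intro allI sum_zip_fun[symmetric])

lemma adj_regroup: "adj (regroup M) = regroup (adj M)"
  by (simp add: vec_eq_iff)

lemma regroup_diag_op: "regroup (diag_op d) = diag_op (\<lambda>p. d (zip_fun p))"
  by (simp add: vec_eq_iff diag_op_nth)

lemma kron_mult: "kron A B ** kron C D = kron (A ** C) (B ** D)"
proof -
  have "(\<Sum>x\<in>UNIV. A $ i $ fst x * B $ j $ snd x * (C $ fst x $ k * D $ snd x $ l)) =
      (\<Sum>a\<in>UNIV. A $ i $ a * C $ a $ k) * (\<Sum>b\<in>UNIV. B $ j $ b * D $ b $ l)" for i j k l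
    unfolding sum_product UNIV_Times_UNIV[symmetric] sum.cartesian_product
    by (rule sum.cong) (auto simp: mult_ac)
  then show ?thesis by (simp add: vec_eq_iff matrix_matrix_mult_def)
qed

lemma adj_kron: "adj (kron A B) = kron (adj A) (adj B)"
  by (simp add: vec_eq_iff)

lemma kron_diag_op: "kron (mat 1) (diag_op d) = diag_op (\<lambda>p. d (snd p))"
  by (auto simp: vec_eq_iff diag_op_nth mat_def)

lemma kron_mat1: "kron (mat 1) (mat 1) = mat 1"
  by (auto simp: vec_eq_iff mat_def)

text \<open>The identity is a tensor power of identities. Thus the eigenbasis of the i.i.d. marginal
  has the same product form as that of the i.i.d. state, and overlaps factorise.\<close>

lemma kron_mat1_tensor_power:
  "kron (mat 1) (tensor_power M) =
    regroup (tensor_power (kron (mat 1 :: 'a::finite operator) M) :: ('k::finite \<Rightarrow> 'a \<times> 'b::finite) operator)"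
proof -
  have "(mat 1 :: ('k \<Rightarrow> 'a) operator) $ x $ y = (\<Prod>k\<in>UNIV. (mat 1 :: 'a operator) $ x k $ y k)" for x y
    by (auto simp: mat_def fun_eq_iff intro!: prod_zero)
  then show ?thesis
    by (simp add: vec_eq_iff zip_fun_def prod.distrib)
qed

lemma unitary_op_tensor_power: "unitary_op U \<Longrightarrow> unitary_op (tensor_power U)"
  unfolding unitary_op_def adj_tensor_power tensor_power_mult[symmetric]
  by (simp add: diag_op_one[symmetric] tensor_power_diag_op)

lemma unitary_op_regroup: "unitary_op U \<Longrightarrow> unitary_op (regroup U)"
  unfolding unitary_op_def adj_regroup regroup_mult[symmetric]
  by (simp add: diag_op_one[symmetric] regroup_diag_op)

lemma unitary_op_kron_mat1: "unitary_op V \<Longrightarrow> unitary_op (kron (mat 1) V)"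
  by (simp add: unitary_op_def adj_kron kron_mult kron_mat1)

lemma kron_unitary_conj: "kron (mat 1) (V ** D ** adj V) = kron (mat 1) V ** kron (mat 1) D ** adj (kron (mat 1) V)"
  by (simp add: adj_kron kron_mult)

lemma tensor_power_unitary_conj:
  "tensor_power (V ** diag_op d ** adj V) =
    tensor_power V ** diag_op (\<lambda>x. \<Prod>k\<in>UNIV. d (x k)) ** adj (tensor_power V)"
  by (simp add: tensor_power_mult tensor_power_diag_op adj_tensor_power)

section \<open>Partial trace\<close>

lemma adj_ptrace_A: "adj (ptrace_A M) = ptrace_A (adj M)"
  by (simp add: vec_eq_iff)

lemma sum_prod_UNIV: "(\<Sum>p\<in>UNIV. f p) = (\<Sum>a\<in>UNIV. \<Sum>b\<in>UNIV. f (a, b))"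
  unfolding sum.cartesian_product UNIV_Times_UNIV[symmetric] by (simp add: case_prod_unfold)

lemma ptrace_A_kron_mult: "ptrace_A (kron (mat 1) X ** M) = X ** ptrace_A M"
proof -
  have "(kron (mat 1) X ** M) $ (a, b) $ q = (\<Sum>c\<in>UNIV. X $ b $ c * M $ (a, c) $ q)" for a b q
    unfolding matrix_matrix_mult_def vec_lambda_beta sum_prod_UNIV
    by (subst sum.swap) (simp add: mat_def if_distrib if_distribR cong: if_cong)
  then show ?thesis
    by (simp add: vec_eq_iff matrix_matrix_mult_def[of X] sum_distrib_left) (intro allI sum.swap)
qed

lemma ptrace_A_mult_kron: "ptrace_A (M ** kron (mat 1) X) = ptrace_A M ** X"
proof -
  have "adj (ptrace_A (M ** kron (mat 1) X)) = adj (ptrace_A M ** X)"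
    by (simp add: adj_ptrace_A adj_mult adj_kron ptrace_A_kron_mult)
  then show ?thesis by (metis adj_adj)
qed

lemma trace_ptrace_A: "trace (ptrace_A M) = trace M"
  by (simp add: trace_def sum_prod_UNIV) (rule sum.swap)

lemma trace_mult_kron: "trace (M ** kron (mat 1) X) = trace (ptrace_A M ** X)"
  by (metis trace_ptrace_A ptrace_A_mult_kron)

section \<open>A state and its marginal in their eigenbases\<close>

lemma Re_trace_two_bases:
  "Re (trace ((U ** diag_op d ** adj U) ** (W ** diag_op e ** adj W))) =
    (\<Sum>i\<in>UNIV. \<Sum>j\<in>UNIV. d i * e j * (cmod ((adj W ** U) $ j $ i))\<^sup>2)"
proof -
  define C where "C = adj W ** U"
  have "trace ((U ** diag_op d ** adj U) ** (W ** diag_op e ** adj W)) =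
      trace ((U ** diag_op d ** adj U ** W ** diag_op e) ** adj W)"
    by (simp only: matrix_mul_assoc)
  also have "\<dots> = trace ((C ** diag_op d) ** (adj C ** diag_op e))"
    by (subst trace_mul_sym) (simp add: C_def adj_mult matrix_mul_assoc)
  also have "\<dots> = trace (adj C ** diag_op e ** (C ** diag_op d))"
    by (rule trace_mul_sym)
  finally have "Re (trace ((U ** diag_op d ** adj U) ** (W ** diag_op e ** adj W))) =
      (\<Sum>i\<in>UNIV. \<Sum>j\<in>UNIV. e j * Re (cnj (C $ j $ i) * (C ** diag_op d) $ j $ i))"
    by (simp only: Re_trace_conj_diag)
  also have "\<dots> = (\<Sum>i\<in>UNIV. \<Sum>j\<in>UNIV. d i * e j * (cmod (C $ j $ i))\<^sup>2)"
  proof (intro sum.cong refl)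
    fix i j
    have "cnj (C $ j $ i) * (C ** diag_op d) $ j $ i = of_real (d i * (cmod (C $ j $ i))\<^sup>2)"
      by (simp only: mult_diag_op_nth of_real_mult complex_norm_square mult_ac)
    then show "e j * Re (cnj (C $ j $ i) * (C ** diag_op d) $ j $ i) = d i * e j * (cmod (C $ j $ i))\<^sup>2"
      by simp
  qed
  finally show ?thesis by (simp only: C_def)
qed

lemma matrix_add_rdistrib: "(A + B) ** C = A ** C + B ** C" for A B C :: "'i::finite operator"
  by (simp add: vec_eq_iff matrix_matrix_mult_def algebra_simps sum.distrib)

lemma unitary_conj_shift:
  fixes U :: "'i::finite operator"
  assumes "unitary_op U"
  shows "U ** diag_op d ** adj U + c *\<^sub>R mat 1 = U ** diag_op (\<lambda>i. d i + c) ** adj U"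
proof -
  have "c *\<^sub>R mat 1 = U ** diag_op (\<lambda>_. c) ** adj U"
  proof -
    have "diag_op (\<lambda>_. c) = c *\<^sub>R (mat 1 :: 'i operator)"
      using diag_op_scaleR[of c "\<lambda>_. 1", symmetric] by (simp add: diag_op_one)
    with assms show ?thesis by (simp only: scaleR_matrix_mult unitary_op_def matrix_mul_rid)
  qed
  then show ?thesis
    by (simp add: diag_op_add[symmetric] matrix_add_ldistrib matrix_add_rdistrib)
qed

text \<open>With \<open>q = r / l\<close> the left-hand side is \<open>q / (1 + q)\<close>, at most
  the minimum of 1 and \<open>q\<close>, which is at most \<open>q powr t\<close>.\<close>

lemma ratio_le_powr:
  fixes r l t :: real
  assumes "0 < r" "0 < l" "0 < t" "t \<le> 1"
  shows "1 - l / (l + r) \<le> (r / l) powr t"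
proof -
  have eq: "1 - l / (l + r) = r / (l + r)" using assms by (simp add: field_simps)
  show ?thesis
  proof (cases "r \<le> l")
    case True
    have "r / (l + r) \<le> r / l" using assms by (intro divide_left_mono) auto
    also have "r / l = (r / l) powr 1" using assms by simp
    also have "\<dots> \<le> (r / l) powr t" using True assms by (intro powr_mono') auto
    finally show ?thesis by (simp add: eq)
  next
    case False
    have "r / (l + r) \<le> 1" using assms by simp
    also have "1 \<le> (r / l) powr t" using False assms by (intro ge_one_powr_ge_zero) auto
    finally show ?thesis by (simp add: eq)
  qed
qed

text \<open>Serves the limit in \<open>cond_entropy_rel\<close>: monotonicity in the regularisation
  makes it an infimum, so a bound at each positive parameter passes to the limit.\<close>

lemma tendsto_INF_at_right:
  fixes f :: "real \<Rightarrow> ereal"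
  assumes "\<And>x y. 0 < x \<Longrightarrow> x \<le> y \<Longrightarrow> f x \<le> f y"
  shows "(f \<longlongrightarrow> (INF x\<in>{0<..}. f x)) (at_right 0)"
proof (rule order_tendstoI)
  fix a assume a: "a < (INF x\<in>{0<..}. f x)"
  have "a < f x" if "0 < x" for x
    using a INF_lower[of x "{0<..}" f] that by (simp add: less_le_trans)
  then show "\<forall>\<^sub>F x in at_right 0. a < f x"
    by (simp add: eventually_at_filter)
next
  fix a assume "(INF x\<in>{0<..}. f x) < a"
  then obtain y where y: "0 < y" "f y < a" by (auto simp: INF_less_iff)
  then have "f x < a" if "0 < x" "x < y" for x
    using assms[of x y] that by (auto intro: le_less_trans)
  then show "\<forall>\<^sub>F x in at_right 0. f x < a"
    using y(1) eventually_at_right_less[of 0] eventually_at_right_field by blast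
qed

text \<open>Fixes one diagonalisation of the state and one of its marginal. That \<open>l\<close> is
  again a probability distribution is derived below, from its being a marginal of
  \<open>p\<close>.\<close>

locale marginal_decomposition =
  fixes \<rho> :: "('a::finite \<times> 'b::finite) operator" and U r V l
  assumes U: "unitary_op U" and V: "unitary_op V"
    and rho: "\<rho> = U ** diag_op r ** adj U" and marginal: "ptrace_A \<rho> = V ** diag_op l ** adj V"
    and r: "\<And>i. 0 \<le> r i" and sum_r: "(\<Sum>i\<in>UNIV. r i) = 1"
begin

text \<open>Transition probabilities between the eigenbasis of \<open>\<rho>\<close> and an
  eigenbasis of \<open>1 \<otimes> \<rho>\<^sub>B\<close>; unitarity makes them doubly
  stochastic.\<close>

definition overlap :: "'a \<times> 'b \<Rightarrow> 'a \<times> 'b \<Rightarrow> real" where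
  "overlap i j = (cmod ((adj (kron (mat 1) V) ** U) $ j $ i))\<^sup>2"

text \<open>The Nussbaum--Szkola distribution: the entropies of \<open>\<rho>\<close> relative to \<open>1 \<otimes> \<rho>\<^sub>B\<close> are classical
  entropies of the likelihood ratio \<open>r i / l (snd j)\<close> under it.\<close>

definition p :: "'a \<times> 'b \<Rightarrow> 'a \<times> 'b \<Rightarrow> real" where
  "p i j = r i * overlap i j"

lemma unitary_C: "unitary_op (adj (kron (mat 1) V) ** U)"
  by (intro unitary_op_mult unitary_op_adj unitary_op_kron_mat1 U V)

lemma overlap_nonneg: "0 \<le> overlap i j"
  by (simp add: overlap_def)

lemma p_nonneg: "0 \<le> p i j"
  by (simp add: p_def r overlap_nonneg)

lemma sum_p_right: "(\<Sum>j\<in>UNIV. p i j) = r i"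
  by (simp add: p_def overlap_def sum_distrib_left[symmetric] unitary_op_row_norm[OF unitary_C])

text \<open>The inner sum is a diagonal entry of \<open>\<rho>\<close> in the eigenbasis of
  \<open>1 \<otimes> \<rho>\<^sub>B\<close>. Conjugation by \<open>kron (mat 1) V\<close> passes
  through the partial trace, where it diagonalises the marginal.\<close>

lemma sum_p_left: "(\<Sum>a\<in>UNIV. \<Sum>i\<in>UNIV. p i (a, b)) = l b"
proof -
  let ?C = "adj (kron (mat 1) V) ** U"
  have diag: "(?C ** diag_op r ** adj ?C) $ j $ j = of_real (\<Sum>i\<in>UNIV. p i j)" for j
  proof -
    have "(?C ** diag_op r ** adj ?C) $ j $ j = (\<Sum>i\<in>UNIV. ?C $ j $ i * of_real (r i) * cnj (?C $ j $ i))"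
      by (simp only: matrix_matrix_mult_def[of "?C ** diag_op r"] mult_diag_op_nth vec_lambda_beta adj_nth)
    also have "\<dots> = (\<Sum>i\<in>UNIV. of_real (p i j))"
      by (simp only: p_def overlap_def of_real_mult complex_norm_square mult_ac)
    finally show ?thesis by simp
  qed
  have "diag_op l = adj V ** ptrace_A \<rho> ** V"
    unfolding marginal using V by (simp add: matrix_mul_assoc unitary_cancel) (simp add: unitary_op_def)
  also have "\<dots> = ptrace_A (kron (mat 1) (adj V) ** \<rho> ** kron (mat 1) V)"
    by (simp add: ptrace_A_mult_kron ptrace_A_kron_mult)
  also have "kron (mat 1) (adj V) ** \<rho> ** kron (mat 1) V = ?C ** diag_op r ** adj ?C"
    by (simp add: rho adj_mult adj_kron matrix_mul_assoc)
  finally have "diag_op l $ b $ b = ptrace_A (?C ** diag_op r ** adj ?C) $ b $ b" by simp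
  then have "complex_of_real (l b) = of_real (\<Sum>a\<in>UNIV. \<Sum>i\<in>UNIV. p i (a, b))"
    by (simp add: diag_op_nth diag del: of_real_sum) simp
  then show ?thesis by (simp only: of_real_eq_iff)
qed

lemma l: "0 \<le> l b"
  by (simp add: sum_p_left[symmetric] sum_nonneg p_nonneg)

lemma sum_l: "(\<Sum>b\<in>UNIV. l b) = 1"
proof -
  have "(\<Sum>b\<in>UNIV. l b) = (\<Sum>j\<in>UNIV. \<Sum>i\<in>UNIV. p i j)"
    unfolding sum_prod_UNIV[of "\<lambda>j. \<Sum>i\<in>UNIV. p i j"] sum_p_left[symmetric] by (rule sum.swap)
  also have "\<dots> = 1"
    by (subst sum.swap) (simp add: sum_p_right sum_r)
  finally show ?thesis .
qed

text \<open>A single weight is at most the marginal \<open>l (snd j)\<close>. So the likelihood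
  ratio is positive wherever \<open>p\<close> charges it, and supports raise no problem.\<close>

lemma p_support:
  assumes "p i j \<noteq> 0" shows "0 < r i" "0 < l (snd j)"
proof -
  show "0 < r i" using assms r[of i] by (auto simp: p_def less_le)
  have "p i j \<le> (\<Sum>i\<in>UNIV. p i j)"
    by (rule member_le_sum) (simp_all add: p_nonneg)
  also have "\<dots> \<le> (\<Sum>a\<in>UNIV. \<Sum>i\<in>UNIV. p i (a, snd j))"
    using member_le_sum[of "fst j" UNIV "\<lambda>a. \<Sum>i\<in>UNIV. p i (a, snd j)"] by (simp add: p_nonneg sum_nonneg)
  finally show "0 < l (snd j)"
    using assms p_nonneg[of i j] by (simp add: sum_p_left)
qed

definition support :: "(('a \<times> 'b) \<times> ('a \<times> 'b)) set" where
  "support = {(i, j). p i j \<noteq> 0}"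

lemma sum_support:
  "(\<Sum>i\<in>UNIV. \<Sum>j\<in>UNIV. p i j * g i j) = (\<Sum>z\<in>support. p (fst z) (snd z) * g (fst z) (snd z))"
proof -
  have "(\<Sum>i\<in>UNIV. \<Sum>j\<in>UNIV. p i j * g i j) = (\<Sum>z\<in>UNIV. p (fst z) (snd z) * g (fst z) (snd z))"
    unfolding sum_prod_UNIV[of "\<lambda>z. p (fst z) (snd z) * g (fst z) (snd z)"] by simp
  also have "\<dots> = (\<Sum>z\<in>support. p (fst z) (snd z) * g (fst z) (snd z))"
    by (rule sum.mono_neutral_right) (auto simp: support_def)
  finally show ?thesis .
qed

lemma sum_p: "(\<Sum>z\<in>support. p (fst z) (snd z)) = 1"
  using sum_support[of "\<lambda>_ _. 1"] by (simp add: sum_p_right sum_r)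

text \<open>This is the trace of \<open>\<rho>\<close> to the power \<open>1 + t\<close> times
  \<open>1 \<otimes> \<rho>\<^sub>B\<close> to the power \<open>- t\<close>, with inverses on
  supports. A ratio with zero denominator carries weight zero.\<close>

definition moment :: "real \<Rightarrow> real" where
  "moment t = (\<Sum>i\<in>UNIV. \<Sum>j\<in>UNIV. p i j * (r i / l (snd j)) powr t)"

text \<open>By \<open>entropy_eq\<close> this is the von Neumann entropy of the state minus that of
  its marginal.\<close>

definition entropy :: real where
  "entropy = - (\<Sum>i\<in>UNIV. \<Sum>j\<in>UNIV. p i j * log 2 (r i / l (snd j)))"

subsection \<open>Smoothing the i.i.d. state\<close>

text \<open>\<open>smoothing\<close> is applied to the tensor power with \<open>l\<close> scaled by
  \<open>2 powr (- m)\<close>. Weights and likelihood ratios factorise over the copies, so the error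
  becomes a power of the one-copy moment.\<close>

lemma iid_smoothing:
  fixes t m :: real
  assumes t: "0 < t" "t \<le> 1"
  obtains \<tau> :: "(('k::finite \<Rightarrow> 'a) \<times> ('k \<Rightarrow> 'b)) operator" where "\<tau> \<in> substates"
    "psd (2 powr (- m) *\<^sub>R kron (mat 1) (tensor_power (ptrace_A \<rho>)) - \<tau>)"
    "1 - 2 powr (m * t) * moment t ^ CARD('k) \<le> fidelity (regroup (tensor_power \<rho>)) \<tau>"
proof -
  define r' :: "('k \<Rightarrow> 'a) \<times> ('k \<Rightarrow> 'b) \<Rightarrow> real" where "r' = (\<lambda>i. \<Prod>k\<in>UNIV. r (zip_fun i k))"
  define l' :: "('k \<Rightarrow> 'a) \<times> ('k \<Rightarrow> 'b) \<Rightarrow> real" where "l' = (\<lambda>j. \<Prod>k\<in>UNIV. l (snd (zip_fun j k)))"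
  define U' :: "(('k \<Rightarrow> 'a) \<times> ('k \<Rightarrow> 'b)) operator" where "U' = regroup (tensor_power U)"
  define W' :: "(('k \<Rightarrow> 'a) \<times> ('k \<Rightarrow> 'b)) operator" where "W' = kron (mat 1) (tensor_power V)"
  have U': "unitary_op U'" and W': "unitary_op W'"
    unfolding U'_def W'_def by (intro unitary_op_regroup unitary_op_tensor_power unitary_op_kron_mat1 U V)+
  have rho': "regroup (tensor_power \<rho>) = U' ** diag_op r' ** adj U'"
    by (simp add: rho tensor_power_unitary_conj regroup_mult regroup_diag_op U'_def r'_def adj_regroup)
  have sigma': "2 powr (- m) *\<^sub>R kron (mat 1) (tensor_power (ptrace_A \<rho>)) =
      W' ** diag_op (\<lambda>j. 2 powr (- m) * l' j) ** adj W'"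
    by (simp add: marginal tensor_power_unitary_conj kron_unitary_conj kron_diag_op W'_def l'_def zip_fun_def
        diag_op_scaleR[symmetric] scaleR_matrix_mult)
  have r'0: "0 \<le> r' i" and l'0: "0 \<le> 2 powr (- m) * l' j" for i j
    by (simp_all add: r'_def l'_def prod_nonneg r l)
  have sum_r': "(\<Sum>i\<in>UNIV. r' i) = 1"
    unfolding r'_def sum_zip_fun[of "\<lambda>x. \<Prod>k\<in>UNIV. r (x k)"] by (simp add: prod_sum_fun[of "\<lambda>_. r", symmetric] sum_r)
  define D where "D i j = (cmod ((adj W' ** U') $ j $ i))\<^sup>2" for i j
  have D: "D i j = (\<Prod>k\<in>UNIV. overlap (zip_fun i k) (zip_fun j k))" for i j
  proof -
    have "adj W' ** U' = regroup (tensor_power (adj (kron (mat 1) V) ** U))"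
      by (simp add: W'_def U'_def kron_mat1_tensor_power adj_regroup adj_tensor_power regroup_mult tensor_power_mult)
    then show ?thesis
      by (simp add: D_def overlap_def prod_norm[symmetric] prod_power_distrib)
  qed
  obtain \<tau> where \<tau>: "\<tau> \<in> substates" "psd (W' ** diag_op (\<lambda>j. 2 powr (- m) * l' j) ** adj W' - \<tau>)"
    and F: "(\<Sum>i\<in>UNIV. \<Sum>j\<in>UNIV. D i j * (r' i * (2 powr (- m) * l' j / (2 powr (- m) * l' j + r' i))))
      \<le> fidelity (U' ** diag_op r' ** adj U') \<tau>"
    by (rule smoothing[OF U' W' r'0 l'0 eq_refl[OF sum_r'], folded D_def]) (rule that)
  \<comment> \<open>The weights \<open>D i j * r' i\<close> form a probability distribution, so the
    loss of fidelity is bounded by one expectation.\<close>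
  have "(\<Sum>i\<in>UNIV. \<Sum>j\<in>UNIV. D i j * r' i) = 1"
    using unitary_op_row_norm(1)[OF unitary_op_mult[OF unitary_op_adj[OF W'] U']] sum_r'
    by (simp add: D_def sum_distrib_right[symmetric])
  then have "1 - fidelity (U' ** diag_op r' ** adj U') \<tau> \<le>
      (\<Sum>i\<in>UNIV. \<Sum>j\<in>UNIV. D i j * r' i) -
      (\<Sum>i\<in>UNIV. \<Sum>j\<in>UNIV. D i j * (r' i * (2 powr (- m) * l' j / (2 powr (- m) * l' j + r' i))))"
    using F by simp
  also have "\<dots> = (\<Sum>i\<in>UNIV. \<Sum>j\<in>UNIV. D i j * r' i * (1 - 2 powr (- m) * l' j / (2 powr (- m) * l' j + r' i)))"
    by (simp add: sum_subtractf[symmetric] right_diff_distrib mult.assoc)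
  also have "\<dots> \<le> (\<Sum>i\<in>UNIV. \<Sum>j\<in>UNIV. 2 powr (m * t) *
      (\<Prod>k\<in>(UNIV::'k set). p (zip_fun i k) (zip_fun j k) * (r (zip_fun i k) / l (snd (zip_fun j k))) powr t))"
  proof (intro sum_mono)
    fix i j
    have Dr: "D i j * r' i = (\<Prod>k\<in>UNIV. p (zip_fun i k) (zip_fun j k))"
      by (simp add: D r'_def p_def prod.distrib mult.commute)
    show "D i j * r' i * (1 - 2 powr (- m) * l' j / (2 powr (- m) * l' j + r' i)) \<le> 2 powr (m * t) *
      (\<Prod>k\<in>(UNIV::'k set). p (zip_fun i k) (zip_fun j k) * (r (zip_fun i k) / l (snd (zip_fun j k))) powr t)"
    \<comment> \<open>Nonzero weights in all factors make \<open>r' i\<close> and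
      \<open>l' j\<close> positive, as \<open>ratio_le_powr\<close> requires; otherwise the
      left-hand side is zero.\<close>
    proof (cases "\<forall>k. p (zip_fun i k) (zip_fun j k) \<noteq> 0")
      case True
      then have pos: "0 < r' i" "0 < l' j"
        unfolding r'_def l'_def by (auto intro!: prod_pos p_support)
      have "1 - 2 powr (- m) * l' j / (2 powr (- m) * l' j + r' i) \<le> (r' i / (2 powr (- m) * l' j)) powr t"
        using pos t by (intro ratio_le_powr) auto
      also have "r' i / (2 powr (- m) * l' j) = 2 powr m * (r' i / l' j)"
        by (simp add: powr_minus field_simps)
      also have "\<dots> powr t = 2 powr (m * t) * (r' i / l' j) powr t"
        by (subst powr_mult) (use pos in \<open>simp_all add: powr_powr\<close>)
      also have "r' i / l' j = (\<Prod>k\<in>UNIV. r (zip_fun i k) / l (snd (zip_fun j k)))"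
        by (simp add: r'_def l'_def prod_dividef)
      also have "\<dots> powr t = (\<Prod>k\<in>UNIV. (r (zip_fun i k) / l (snd (zip_fun j k))) powr t)"
        by (simp add: prod_powr_distrib r l)
      finally have "D i j * r' i * (1 - 2 powr (- m) * l' j / (2 powr (- m) * l' j + r' i)) \<le>
          D i j * r' i * (2 powr (m * t) * (\<Prod>k\<in>UNIV. (r (zip_fun i k) / l (snd (zip_fun j k))) powr t))"
        by (rule mult_left_mono) (simp add: D_def r'0)
      then show ?thesis unfolding Dr prod.distrib by (simp only: mult_ac)
    next
      case False
      then have "D i j * r' i = 0" unfolding Dr by auto
      moreover have "0 \<le> (\<Prod>k\<in>(UNIV::'k set). p (zip_fun i k) (zip_fun j k) * (r (zip_fun i k) / l (snd (zip_fun j k))) powr t)"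
        by (intro prod_nonneg) (simp add: p_nonneg)
      ultimately show ?thesis by (simp only: mult_zero_left) simp
    qed
  qed
  also have "\<dots> = 2 powr (m * t) * moment t ^ CARD('k)"
  proof -
    let ?f = "\<lambda>i j. p i j * (r i / l (snd j)) powr t"
    have "(\<Sum>i\<in>UNIV. \<Sum>j\<in>UNIV. \<Prod>k\<in>(UNIV::'k set). ?f (zip_fun i k) (zip_fun j k)) =
        (\<Sum>x\<in>UNIV. \<Sum>y\<in>UNIV. \<Prod>k\<in>(UNIV::'k set). ?f (x k) (y k))"
      unfolding sum_zip_fun[of "\<lambda>y. \<Prod>k\<in>UNIV. ?f (zip_fun _ k) (y k)"]
      by (rule sum_zip_fun[of "\<lambda>x. \<Sum>y\<in>UNIV. \<Prod>k\<in>UNIV. ?f (x k) (y k)"])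
    also have "\<dots> = (\<Sum>x\<in>UNIV. \<Prod>k\<in>(UNIV::'k set). \<Sum>j\<in>UNIV. ?f (x k) j)"
      by (simp add: prod_sum_fun)
    also have "\<dots> = (\<Prod>k\<in>(UNIV::'k set). \<Sum>i\<in>UNIV. \<Sum>j\<in>UNIV. ?f i j)"
      by (rule prod_sum_fun[symmetric])
    finally show ?thesis by (simp add: moment_def sum_distrib_left[symmetric])
  qed
  finally have "1 - 2 powr (m * t) * moment t ^ CARD('k) \<le> fidelity (U' ** diag_op r' ** adj U') \<tau>"
    by simp
  with \<tau> that show thesis by (simp only: rho' sigma')
qed

subsection \<open>The conditional entropy\<close>

lemma entropy_eq: "entropy = (\<Sum>b\<in>UNIV. l b * log 2 (l b)) - (\<Sum>i\<in>UNIV. r i * log 2 (r i))"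
proof -
  have "p i j * log 2 (r i / l (snd j)) = p i j * log 2 (r i) - p i j * log 2 (l (snd j))" for i j
    using p_support[of i j] by (cases "p i j = 0") (simp_all add: log_divide right_diff_distrib)
  then have "entropy = (\<Sum>i\<in>UNIV. \<Sum>j\<in>UNIV. p i j * log 2 (l (snd j))) - (\<Sum>i\<in>UNIV. \<Sum>j\<in>UNIV. p i j * log 2 (r i))"
    by (simp add: entropy_def sum_subtractf)
  also have "(\<Sum>i\<in>UNIV. \<Sum>j\<in>UNIV. p i j * log 2 (r i)) = (\<Sum>i\<in>UNIV. r i * log 2 (r i))"
    by (simp add: sum_distrib_right[symmetric] sum_p_right)
  also have "(\<Sum>i\<in>UNIV. \<Sum>j\<in>UNIV. p i j * log 2 (l (snd j))) = (\<Sum>j\<in>UNIV. (\<Sum>i\<in>UNIV. p i j) * log 2 (l (snd j)))"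
    by (subst sum.swap) (simp add: sum_distrib_right)
  also have "\<dots> = (\<Sum>b\<in>UNIV. \<Sum>a\<in>UNIV. (\<Sum>i\<in>UNIV. p i (a, b)) * log 2 (l b))"
    unfolding sum_prod_UNIV[of "\<lambda>j. (\<Sum>i\<in>UNIV. p i j) * log 2 (l (snd j))"] by (subst sum.swap) simp
  also have "\<dots> = (\<Sum>b\<in>UNIV. l b * log 2 (l b))"
    by (simp add: sum_distrib_right[symmetric] sum_p_left)
  finally show ?thesis .
qed

text \<open>The Gibbs inequality: only the marginal of \<open>\<rho>\<close> meets
  \<open>\<sigma>\<close>, and the claim reduces to nonnegativity of their relative entropy, taken
  in both eigenbases with the doubly stochastic overlaps \<open>E\<close>.\<close>

lemma cond_entropy_rel_le:
  assumes "\<sigma> \<in> states"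
  shows "cond_entropy_rel \<rho> \<sigma> \<le> ereal entropy"
proof -
  have "psd \<sigma>" using assms by (simp add: states_def)
  then obtain X s where X: "unitary_op X" and \<sigma>: "\<sigma> = X ** diag_op s ** adj X" and s: "\<And>i. 0 \<le> s i"
    by (rule psd_decomposition) (rule that)
  have sum_s: "(\<Sum>k\<in>UNIV. s k) = 1"
  proof -
    have "complex_of_real (\<Sum>k\<in>UNIV. s k) = 1"
      using assms by (simp only: states_def \<sigma> trace_unitary_conj[OF X] trace_diag_op mem_Collect_eq)
    then show ?thesis by (simp only: of_real_eq_1_iff)
  qed
  define E where "E j k = (cmod ((adj X ** V) $ k $ j))\<^sup>2" for j k
  have E: "0 \<le> E j k" "(\<Sum>k\<in>UNIV. E j k) = 1" "(\<Sum>j\<in>UNIV. E j k) = 1" for j k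
    using unitary_op_row_norm[OF unitary_op_mult[OF unitary_op_adj[OF X] V]] by (simp_all add: E_def)
  define f where "f \<xi> = Re (trace (\<rho> ** (kron (mat 1) (op_log (\<sigma> + \<xi> *\<^sub>R mat 1)) - op_log \<rho>)))" for \<xi>
  have f: "f \<xi> = (\<Sum>j\<in>UNIV. \<Sum>k\<in>UNIV. l j * log 2 (s k + \<xi>) * E j k) - (\<Sum>i\<in>UNIV. r i * log 2 (r i))" for \<xi>
  proof -
    have "op_log (\<sigma> + \<xi> *\<^sub>R mat 1) = X ** diag_op (\<lambda>k. log 2 (s k + \<xi>)) ** adj X"
      unfolding op_log_def \<sigma> unitary_conj_shift[OF X] by (rule op_fun_eq[OF X refl])
    then have "Re (trace (\<rho> ** kron (mat 1) (op_log (\<sigma> + \<xi> *\<^sub>R mat 1)))) =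
        (\<Sum>j\<in>UNIV. \<Sum>k\<in>UNIV. l j * log 2 (s k + \<xi>) * E j k)"
      by (simp only: trace_mult_kron marginal Re_trace_two_bases E_def)
    moreover have "op_log \<rho> = U ** diag_op (\<lambda>i. log 2 (r i)) ** adj U"
      unfolding op_log_def by (rule op_fun_eq[OF U rho])
    then have "trace (\<rho> ** op_log \<rho>) = of_real (\<Sum>i\<in>UNIV. r i * log 2 (r i))"
      by (simp only: rho unitary_conj_mult[OF U] diag_op_mult trace_unitary_conj[OF U] trace_diag_op)
    ultimately show ?thesis
      by (simp add: f_def matrix_diff_distrib trace_sub)
  qed
  have mono: "ereal (f x) \<le> ereal (f y)" if "0 < x" "x \<le> y" for x y
    unfolding f using that s E(1) l
    by (auto intro!: sum_mono mult_right_mono mult_left_mono diff_right_mono log_mono simp: add_nonneg_pos)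
  \<comment> \<open>The regularisation adds \<open>\<xi>\<close> to each of the
    \<open>CARD('b)\<close> eigenvalues of \<open>\<sigma>\<close>; \<open>ln 2\<close> converts
    from natural logarithms.\<close>
  define c where "c = real CARD('b) / ln 2"
  have "c > 0" by (simp add: c_def)
  have bound: "f \<xi> \<le> entropy + \<xi> * c" if "0 < \<xi>" for \<xi>
  proof -
    \<comment> \<open>This is \<open>ln x \<le> x - 1\<close> multiplied by \<open>l j\<close>, in
      which form it holds for \<open>l j = 0\<close> as well. Summed over \<open>j\<close> and
      \<open>k\<close>, the last term leaves only the trace of the regularisation.\<close>
    have "l j * log 2 (s k + \<xi>) * E j k \<le> l j * log 2 (l j) * E j k + E j k * (s k + \<xi> - l j) / ln 2" for j k
    proof (cases "l j = 0")
      case True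
      then show ?thesis using s[of k] that E(1) by simp
    next
      case False
      then have lj: "0 < l j" using l[of j] by simp
      have sk: "0 < s k + \<xi>" using s[of k] that by simp
      have "ln ((s k + \<xi>) / l j) \<le> (s k + \<xi>) / l j - 1"
        using lj sk by (intro ln_le_minus_one) simp
      then have "l j * ln ((s k + \<xi>) / l j) \<le> l j * ((s k + \<xi>) / l j - 1)"
        using lj by (intro mult_left_mono) auto
      also have "\<dots> = s k + \<xi> - l j" using lj by (simp add: field_simps)
      finally have "l j * (ln (s k + \<xi>) - ln (l j)) \<le> s k + \<xi> - l j"
        using lj sk by (simp add: ln_div)
      then have "E j k * (l j * (ln (s k + \<xi>) - ln (l j))) / ln 2 \<le> E j k * (s k + \<xi> - l j) / ln 2"
        using E(1) by (intro divide_right_mono mult_left_mono) auto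
      then show ?thesis by (simp add: log_def algebra_simps diff_divide_distrib)
    qed
    then have "f \<xi> \<le> (\<Sum>j\<in>UNIV. \<Sum>k\<in>UNIV. l j * log 2 (l j) * E j k + E j k * (s k + \<xi> - l j) / ln 2)
        - (\<Sum>i\<in>UNIV. r i * log 2 (r i))"
      unfolding f by (intro diff_right_mono sum_mono)
    also have "(\<Sum>j\<in>UNIV. \<Sum>k\<in>UNIV. l j * log 2 (l j) * E j k + E j k * (s k + \<xi> - l j) / ln 2) =
        (\<Sum>j\<in>UNIV. l j * log 2 (l j)) + (\<Sum>j\<in>UNIV. \<Sum>k\<in>UNIV. E j k * (s k + \<xi> - l j)) / ln 2"
      by (simp add: sum.distrib sum_distrib_left[symmetric] E(2) sum_divide_distrib[symmetric])
    also have "(\<Sum>j\<in>UNIV. \<Sum>k\<in>UNIV. E j k * (s k + \<xi> - l j)) =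
        (\<Sum>j\<in>UNIV. \<Sum>k\<in>UNIV. E j k * (s k + \<xi>)) - (\<Sum>j\<in>UNIV. \<Sum>k\<in>UNIV. E j k * l j)"
      by (simp add: right_diff_distrib sum_subtractf)
    also have "(\<Sum>j\<in>UNIV. \<Sum>k\<in>UNIV. E j k * (s k + \<xi>)) = 1 + CARD('b) * \<xi>"
      by (subst sum.swap) (simp add: sum_distrib_right[symmetric] E(3) sum.distrib sum_s)
    also have "(\<Sum>j\<in>UNIV. \<Sum>k\<in>UNIV. E j k * l j) = 1"
      by (simp add: sum_distrib_right[symmetric] E(2) sum_l)
    finally show ?thesis by (simp add: entropy_eq c_def mult.commute)
  qed
  have "cond_entropy_rel \<rho> \<sigma> = (INF \<xi>\<in>{0<..}. ereal (f \<xi>))"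
    unfolding cond_entropy_rel_def f_def[symmetric]
    by (rule tendsto_Lim) (simp_all add: tendsto_INF_at_right[OF mono])
  also have "\<dots> \<le> ereal entropy"
  proof (rule ereal_le_epsilon2)
    fix e :: real assume e: "0 < e"
    have "(INF \<xi>\<in>{0<..}. ereal (f \<xi>)) \<le> ereal (f (e / c))"
      using e \<open>c > 0\<close> by (intro INF_lower) simp
    also have "\<dots> \<le> ereal (entropy + e)"
      using bound[of "e / c"] e \<open>c > 0\<close> by simp
    finally show "(INF \<xi>\<in>{0<..}. ereal (f \<xi>)) \<le> ereal entropy + ereal e" by simp
  qed
  finally show ?thesis .
qed

lemma cond_entropy_le: "cond_entropy \<rho> \<le> ereal entropy"
  unfolding cond_entropy_def by (intro SUP_least cond_entropy_rel_le)


subsection \<open>The convergence parameter\<close>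

text \<open>The spectrum \<open>s\<close> on the eigenvectors \<open>V\<close> is a parameter, so
  that one formula covers the marginal and its shifts by \<open>\<xi>\<close>.\<close>

definition overlap_sum :: "real \<Rightarrow> ('b \<Rightarrow> real) \<Rightarrow> real" where
  "overlap_sum \<alpha> s = (\<Sum>i\<in>UNIV. \<Sum>j\<in>UNIV. r i powr \<alpha> * s (snd j) powr (1 - \<alpha>) * overlap i j)"

lemma alpha_entropy_inv_eq:
  "alpha_entropy_inv \<alpha> \<rho> (V ** diag_op s ** adj V) = 1 / (1 - \<alpha>) * log 2 (overlap_sum \<alpha> s)"
proof -
  let ?W = "kron (mat 1 :: 'a operator) V"
  have W: "unitary_op ?W" by (intro unitary_op_kron_mat1 V)
  have "op_powr \<rho> \<alpha> = U ** diag_op (\<lambda>i. r i powr \<alpha>) ** adj U"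
    unfolding op_powr_def by (rule op_fun_eq[OF U rho])
  moreover have "kron (mat 1) (V ** diag_op s ** adj V) = ?W ** diag_op (\<lambda>j. s (snd j)) ** adj ?W"
    by (simp add: kron_unitary_conj kron_diag_op)
  then have "op_powr (kron (mat 1) (V ** diag_op s ** adj V)) (1 - \<alpha>) =
      ?W ** diag_op (\<lambda>j. s (snd j) powr (1 - \<alpha>)) ** adj ?W"
    unfolding op_powr_def by (rule op_fun_eq[OF W])
  ultimately show ?thesis
    by (simp only: alpha_entropy_inv_def Re_trace_two_bases overlap_sum_def overlap_def)
qed

lemma overlap_sum_marginal: "overlap_sum \<alpha> l = moment (\<alpha> - 1)"
  unfolding overlap_sum_def moment_def
proof (intro sum.cong refl)
  fix i j
  show "r i powr \<alpha> * l (snd j) powr (1 - \<alpha>) * overlap i j = p i j * (r i / l (snd j)) powr (\<alpha> - 1)"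
  proof (cases "p i j = 0")
    case True
    then show ?thesis by (auto simp: p_def)
  next
    case False
    then have pos: "0 < r i" "0 < l (snd j)" using p_support by auto
    have "r i powr \<alpha> = r i * r i powr (\<alpha> - 1)" "l (snd j) powr (1 - \<alpha>) = 1 / l (snd j) powr (\<alpha> - 1)"
      using pos by (simp_all add: powr_mult_base powr_minus_divide[symmetric])
    then show ?thesis using pos by (simp add: p_def powr_divide)
  qed
qed

lemma moment_pos: "0 < moment t"
proof -
  have "moment t = (\<Sum>z\<in>support. p (fst z) (snd z) * (r (fst z) / l (snd (snd z))) powr t)"
    unfolding moment_def by (rule sum_support)
  also have "\<dots> > 0"
  proof (rule sum_pos)
    show "support \<noteq> {}" using sum_p by auto
    fix z assume "z \<in> support"
    then have "p (fst z) (snd z) \<noteq> 0" by (auto simp: support_def)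
    then show "0 < p (fst z) (snd z) * (r (fst z) / l (snd (snd z))) powr t"
      using p_support[of "fst z" "snd z"] p_nonneg[of "fst z" "snd z"] by (simp add: less_le)
  qed simp
  finally show ?thesis .
qed

text \<open>If \<open>l (snd j) = 0\<close>, the power may diverge, but then
  \<open>p i j = 0\<close> and the term vanishes for every \<open>\<xi>\<close>. The other terms are
  continuous at 0.\<close>

lemma overlap_sum_tendsto:
  "((\<lambda>\<xi>. overlap_sum \<alpha> (\<lambda>b. l b + \<xi>)) \<longlongrightarrow> overlap_sum \<alpha> l) (at_right 0)"
  unfolding overlap_sum_def
proof (intro tendsto_sum)
  fix i j
  show "((\<lambda>\<xi>. r i powr \<alpha> * (l (snd j) + \<xi>) powr (1 - \<alpha>) * overlap i j) \<longlongrightarrow>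
      r i powr \<alpha> * l (snd j) powr (1 - \<alpha>) * overlap i j) (at_right 0)"
  proof (cases "p i j = 0")
    case True
    then have "r i powr \<alpha> = 0 \<or> overlap i j = 0" by (auto simp: p_def)
    then show ?thesis by auto
  next
    case False
    have "((\<lambda>\<xi>. l (snd j) + \<xi>) \<longlongrightarrow> l (snd j) + 0) (at_right 0)"
      by (intro tendsto_intros)
    then have "((\<lambda>\<xi>. (l (snd j) + \<xi>) powr (1 - \<alpha>)) \<longlongrightarrow> l (snd j) powr (1 - \<alpha>)) (at_right 0)"
      using p_support(2)[OF False] by (intro tendsto_powr tendsto_const) auto
    then show ?thesis by (intro tendsto_mult tendsto_const)
  qed
qed

lemma alpha_entropy_marginal:
  "alpha_entropy \<alpha> \<rho> (ptrace_A \<rho>) = ereal (1 / (1 - \<alpha>) * log 2 (moment (\<alpha> - 1)))"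
proof (cases "invertible (ptrace_A \<rho>)")
  case True
  then show ?thesis
    by (simp add: alpha_entropy_def) (simp add: marginal alpha_entropy_inv_eq overlap_sum_marginal)
next
  case False
  have "((\<lambda>\<xi>. ereal (1 / (1 - \<alpha>) * log 2 (overlap_sum \<alpha> (\<lambda>b. l b + \<xi>)))) \<longlongrightarrow>
      ereal (1 / (1 - \<alpha>) * log 2 (moment (\<alpha> - 1)))) (at_right 0)"
    using moment_pos[of "\<alpha> - 1"] overlap_sum_tendsto[of \<alpha>, unfolded overlap_sum_marginal]
    by (intro tendsto_ereal tendsto_mult tendsto_const tendsto_log) auto
  then have "Lim (at_right 0) (\<lambda>\<xi>. ereal (1 / (1 - \<alpha>) * log 2 (overlap_sum \<alpha> (\<lambda>b. l b + \<xi>)))) =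
      ereal (1 / (1 - \<alpha>) * log 2 (moment (\<alpha> - 1)))"
    by (intro tendsto_Lim) auto
  moreover have "alpha_entropy_inv \<alpha> \<rho> (ptrace_A \<rho> + \<xi> *\<^sub>R mat 1) =
      1 / (1 - \<alpha>) * log 2 (overlap_sum \<alpha> (\<lambda>b. l b + \<xi>))" for \<xi>
    by (simp only: marginal unitary_conj_shift[OF V] alpha_entropy_inv_eq)
  ultimately show ?thesis
    using False by (simp only: alpha_entropy_def if_False)
qed

lemma Upsilon_marginal: "Upsilon \<rho> (ptrace_A \<rho>) = ereal (moment (1/2) + moment (- 1/2) + 1)"
proof -
  \<comment> \<open>In both terms of \<open>Upsilon\<close> the outer factor cancels
    \<open>1 / (1 - \<alpha>)\<close>, so that the moments themselves remain.\<close>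
  have "2 powr (- (1 / 2) * (1 / (1 - 3 / 2) * log 2 (moment (1/2)))) = moment (1/2)"
    "2 powr (1 / 2 * (1 / (1 - 1 / 2) * log 2 (moment (- 1/2)))) = moment (- 1/2)"
    by (simp_all add: moment_pos)
  then show ?thesis
    by (simp add: Upsilon_def alpha_entropy_marginal one_ereal_def)
qed

lemma moment_bounds:
  defines "\<eta> \<equiv> moment (1/2) + moment (- 1/2) + 1"
  shows "3 \<le> \<eta>"
    and "0 < t \<Longrightarrow> 4 * t * log 2 \<eta> \<le> log 2 3 \<Longrightarrow>
      moment t \<le> 2 powr (4 * t\<^sup>2 * (log 2 \<eta>)\<^sup>2 - t * entropy)"
proof -
  let ?p = "\<lambda>z. p (fst z) (snd z)" and ?x = "\<lambda>z. r (fst z) / l (snd (snd z))"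
  have x: "0 < ?x z" if "z \<in> support" for z
    using that p_support[of "fst z" "snd z"] by (auto simp: support_def)
  have m: "moment t = (\<Sum>z\<in>support. ?p z * ?x z powr t)" for t
    unfolding moment_def by (rule sum_support)
  have "moment (1/2) = (\<Sum>z\<in>support. ?p z * sqrt (?x z))"
    unfolding m by (intro sum.cong refl) (use x in \<open>simp add: powr_half_sqrt less_imp_le\<close>)
  moreover have "moment (- 1/2) = (\<Sum>z\<in>support. ?p z * (1 / sqrt (?x z)))"
    unfolding m
  proof (intro sum.cong refl)
    fix z assume "z \<in> support"
    then have "?x z powr (- 1/2) = 1 / sqrt (?x z)"
      using x[of z] by (simp add: powr_half_sqrt[symmetric] powr_minus_divide del: real_sqrt_divide)
    then show "?p z * ?x z powr (- 1/2) = ?p z * (1 / sqrt (?x z))" by simp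
  qed
  ultimately have \<eta>: "\<eta> = (\<Sum>z\<in>support. ?p z * sqrt (?x z)) + (\<Sum>z\<in>support. ?p z * (1 / sqrt (?x z))) + 1"
    by (simp add: \<eta>_def)
  show "3 \<le> \<eta>"
    unfolding \<eta> by (rule sqrt_moments_ge_3[OF p_nonneg sum_p x])
  have ent: "(\<Sum>z\<in>support. ?p z * log 2 (?x z)) = - entropy"
    unfolding entropy_def sum_support[of "\<lambda>i j. log 2 (r i / l (snd j))"] by simp
  assume "0 < t" "4 * t * log 2 \<eta> \<le> log 2 3"
  then have "moment t \<le> 2 powr (t * - entropy + 4 * t\<^sup>2 * (log 2 \<eta>)\<^sup>2)"
    using log_likelihood_moment[where I = support and p = ?p and x = ?x, OF finite p_nonneg sum_p x]
    unfolding \<eta> ent m[symmetric] by blast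
  then show "moment t \<le> 2 powr (4 * t\<^sup>2 * (log 2 \<eta>)\<^sup>2 - t * entropy)"
    by (simp add: algebra_simps)
qed

subsection \<open>The smooth min-entropy\<close>

text \<open>With \<open>m\<close> the claimed bound, the exponent in \<open>iid_smoothing\<close> is
  quadratic in \<open>t\<close> with minimum \<open>- L\<close>. This gives fidelity at least
  \<open>1 - \<epsilon>\<^sup>2 / 2\<close>, hence purified distance at most
  \<open>\<epsilon>\<close>.\<close>

lemma smooth_min_entropy_iid_ge:
  fixes \<epsilon> :: real
  assumes \<epsilon>: "0 < \<epsilon>" "\<epsilon> < 1"
    and n: "8 / 5 * log 2 (2 / \<epsilon>\<^sup>2) \<le> real CARD('k::finite)"
  defines "\<eta> \<equiv> moment (1/2) + moment (- 1/2) + 1"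
  shows "ereal (CARD('k) * entropy - delta \<epsilon> \<eta> * sqrt CARD('k)) \<le>
    smooth_min_entropy \<epsilon> (regroup (tensor_power \<rho>) :: (('k \<Rightarrow> 'a) \<times> ('k \<Rightarrow> 'b)) operator)"
proof -
  define n where "n = real CARD('k)"
  define L where "L = log 2 (2 / \<epsilon>\<^sup>2)"
  define g where "g = log 2 \<eta>"
  \<comment> \<open>The minimiser of \<open>4 * n * g\<^sup>2 * t\<^sup>2 - delta \<epsilon> \<eta>
    * sqrt n * t\<close>, where the two terms are \<open>L\<close> and \<open>2 * L\<close>.\<close>
  define t where "t = sqrt (L / n) / (2 * g)"
  define m where "m = n * entropy - delta \<epsilon> \<eta> * sqrt n"
  have "\<epsilon>\<^sup>2 < 1" using \<epsilon> by (simp add: power_less_one_iff)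
  then have L: "0 < L" unfolding L_def using \<epsilon> by (subst zero_less_log_cancel_iff) auto
  have n0: "0 < n" by (simp add: n_def)
  have nL: "8 / 5 * L \<le> n" using n by (simp add: n_def L_def)
  have \<eta>3: "3 \<le> \<eta>" unfolding \<eta>_def by (rule moment_bounds(1))
  \<comment> \<open>From \<open>2 ^ 19 \<le> 3 ^ 12\<close>.\<close>
  have log3: "19 / 12 \<le> log 2 (3::real)"
  proof -
    have "log 2 (2 ^ 19) \<le> log 2 (3 ^ 12 :: real)" by (intro log_mono) auto
    then show ?thesis by (simp only: log_nat_power) (simp add: log_nat_power)
  qed
  have g: "log 2 3 \<le> g" unfolding g_def using \<eta>3 by (intro log_mono) auto
  then have g0: "0 < g" using log3 by linarith
  have t0: "0 < t" using L n0 g0 by (simp add: t_def)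
  \<comment> \<open>The constant 8/5 enters here: 5/8 is just below the square of 19/24, which keeps
    \<open>4 * t * g\<close> within \<open>log 2 3\<close>, as \<open>moment_bounds\<close>
    requires.\<close>
  have "2 * sqrt (L / n) \<le> 19 / 12"
  proof -
    have "L / n \<le> 5 / 8" using nL n0 by (simp add: divide_simps)
    also have "5 / 8 \<le> (19 / 24 :: real)\<^sup>2" by (simp add: power2_eq_square)
    finally have "sqrt (L / n) \<le> 19 / 24" by (intro real_le_lsqrt) auto
    then show ?thesis by simp
  qed
  moreover have "4 * t * g = 2 * sqrt (L / n)" using g0 by (simp add: t_def)
  ultimately have tg: "4 * t * g \<le> log 2 3" using log3 by linarith
  have "4 * t * g \<le> 1 * g" using tg g by linarith
  then have t1: "t \<le> 1" using g0 by (simp only: mult_le_cancel_right) auto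
  obtain \<tau> :: "(('k \<Rightarrow> 'a) \<times> ('k \<Rightarrow> 'b)) operator" where \<tau>: "\<tau> \<in> substates"
    "psd (2 powr (- m) *\<^sub>R kron (mat 1) (tensor_power (ptrace_A \<rho>)) - \<tau>)"
    and F: "1 - 2 powr (m * t) * moment t ^ CARD('k) \<le> fidelity (regroup (tensor_power \<rho>)) \<tau>"
    by (rule iid_smoothing[OF t0 t1]) (rule that)
  have "moment t \<le> 2 powr (4 * t\<^sup>2 * g\<^sup>2 - t * entropy)"
    using moment_bounds(2)[OF t0] tg by (simp add: \<eta>_def g_def)
  then have "2 powr (m * t) * moment t ^ CARD('k) \<le> 2 powr (m * t) * (2 powr (4 * t\<^sup>2 * g\<^sup>2 - t * entropy)) ^ CARD('k)"
    using moment_pos[of t] by (intro mult_left_mono power_mono) auto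
  also have "\<dots> = 2 powr (m * t + n * (4 * t\<^sup>2 * g\<^sup>2 - t * entropy))"
    by (simp add: powr_add n_def powr_power mult.commute)
  also have "m * t + n * (4 * t\<^sup>2 * g\<^sup>2 - t * entropy) = - L"
  proof -
    have t: "t * (2 * g) = sqrt L / sqrt n"
      using g0 by (simp add: t_def real_sqrt_divide)
    have "delta \<epsilon> \<eta> * sqrt n * t = 2 * sqrt L * sqrt n * (t * (2 * g))"
      by (simp add: delta_def g_def L_def)
    also have "\<dots> = 2 * L"
      unfolding t using n0 L by simp
    finally have a: "delta \<epsilon> \<eta> * sqrt n * t = 2 * L" .
    have "n * (4 * t\<^sup>2 * g\<^sup>2) = n * (t * (2 * g))\<^sup>2"
      by (simp add: power_mult_distrib)
    also have "\<dots> = L"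
      unfolding t using n0 L by (simp add: power_divide)
    finally show ?thesis using a by (simp add: m_def algebra_simps)
  qed
  also have "2 powr (- L) = \<epsilon>\<^sup>2 / 2"
    using \<epsilon> by (simp add: L_def powr_minus)
  finally have "1 - \<epsilon>\<^sup>2 / 2 \<le> fidelity (regroup (tensor_power \<rho>)) \<tau>" using F by linarith
  then have "(1 - \<epsilon>\<^sup>2 / 2)\<^sup>2 \<le> (fidelity (regroup (tensor_power \<rho>)) \<tau>)\<^sup>2"
    using \<open>\<epsilon>\<^sup>2 < 1\<close> by (intro power_mono) auto
  moreover have "(1 - \<epsilon>\<^sup>2 / 2)\<^sup>2 = 1 - \<epsilon>\<^sup>2 + (\<epsilon>\<^sup>2 / 2)\<^sup>2"
    by (simp add: power2_eq_square field_simps)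
  ultimately have "1 - (fidelity (regroup (tensor_power \<rho>)) \<tau>)\<^sup>2 \<le> \<epsilon>\<^sup>2"
    using zero_le_power2[of "\<epsilon>\<^sup>2 / 2"] by linarith
  then have "sqrt (1 - (fidelity (regroup (tensor_power \<rho>)) \<tau>)\<^sup>2) \<le> sqrt (\<epsilon>\<^sup>2)"
    by (rule real_sqrt_le_mono)
  then have ball: "\<tau> \<in> eps_ball \<epsilon> (regroup (tensor_power \<rho>))"
    using \<tau>(1) \<epsilon> by (simp add: eps_ball_def purified_dist_def)
  \<comment> \<open>The i.i.d. marginal is the witness for the supremum in
    \<open>min_entropy\<close>.\<close>
  have "tensor_power (ptrace_A \<rho>) \<in> (states :: ('k \<Rightarrow> 'b) operator set)"
  proof -
    have "(\<Sum>x\<in>UNIV. \<Prod>k\<in>(UNIV::'k set). l (x k)) = 1"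
      by (simp add: prod_sum_fun[of "\<lambda>_. l", symmetric] sum_l)
    then show ?thesis
      unfolding states_def marginal tensor_power_unitary_conj
      by (simp add: trace_unitary_conj unitary_op_tensor_power V trace_diag_op psd_congruence psd_diag_op prod_nonneg l
          del: of_real_sum)
  qed
  moreover have "ereal m \<le> min_entropy_rel \<tau> (tensor_power (ptrace_A \<rho>))"
    unfolding min_entropy_rel_def using \<tau>(2) by (intro Sup_upper) auto
  ultimately have "ereal m \<le> min_entropy \<tau>"
    unfolding min_entropy_def by (rule SUP_upper2)
  with ball have "ereal m \<le> smooth_min_entropy \<epsilon> (regroup (tensor_power \<rho>) :: (('k \<Rightarrow> 'a) \<times> ('k \<Rightarrow> 'b)) operator)"
    unfolding smooth_min_entropy_def by (rule SUP_upper2)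
  then show ?thesis by (simp add: m_def n_def)
qed

end

section \<open>Existence of the decomposition, large smoothing parameters, and conclusion\<close>

lemma marginal_decomposition_exists:
  assumes "\<rho> \<in> states"
  obtains U r V l where "marginal_decomposition \<rho> U r V l"
proof -
  have "psd \<rho>" using assms by (simp add: states_def)
  then obtain U r where U: "unitary_op U" "\<rho> = U ** diag_op r ** adj U" "\<And>i. 0 \<le> r i"
    by (rule psd_decomposition) (rule that)
  have "adj (ptrace_A \<rho>) = ptrace_A \<rho>"
    using \<open>psd \<rho>\<close> by (simp add: adj_ptrace_A psd_iff)
  then obtain V l where V: "unitary_op V" "ptrace_A \<rho> = V ** diag_op l ** adj V"
    by (rule spectral_theorem) (rule that)
  have "complex_of_real (\<Sum>i\<in>UNIV. r i) = 1"
    using assms by (simp only: states_def mem_Collect_eq U(2) trace_unitary_conj[OF U(1)] trace_diag_op)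
  then have "(\<Sum>i\<in>UNIV. r i) = 1" by (simp only: of_real_eq_1_iff)
  with U V have "marginal_decomposition \<rho> U r V l" by (intro marginal_decomposition.intro)
  then show thesis by (rule that)
qed

text \<open>The zero operator has fidelity 0 with every state, hence purified distance 1, and so
  lies in the ball; its min-entropy is infinite.\<close>

lemma smooth_min_entropy_eq_PInfty:
  assumes "1 \<le> \<epsilon>"
  shows "smooth_min_entropy \<epsilon> (\<rho> :: ('a::finite \<times> 'b::finite) operator) = \<infinity>"
proof -
  have sq0: "op_sqrt (0 :: 'i::finite operator) = 0"
    using op_sqrt_psd[OF psd_zero] mult_adj_eq_0 by metis
  have "fidelity \<rho> 0 = 0"
    by (simp add: fidelity_def op_abs_def sq0 matrix_mult_zero trace_def)
  then have "0 \<in> eps_ball \<epsilon> \<rho>"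
    using assms by (simp add: eps_ball_def substates_def psd_zero purified_dist_def trace_def)
  \<comment> \<open>Any state will do; the maximally mixed one shows that the supremum is not over
    an empty set.\<close>
  obtain \<sigma> :: "'b operator" where \<sigma>: "\<sigma> \<in> states"
  proof
    have "(\<Sum>i\<in>(UNIV::'b set). 1 / real CARD('b)) = 1" by simp
    then show "diag_op (\<lambda>_::'b. 1 / real CARD('b)) \<in> states"
      unfolding states_def mem_Collect_eq trace_diag_op by (intro conjI psd_diag_op) simp_all
  qed
  then have "psd \<sigma>" by (simp add: states_def)
  then obtain V s where V: "\<sigma> = V ** diag_op s ** adj V" "\<And>i. 0 \<le> s i"
    by (rule psd_decomposition) (rule that)
  have "psd ((2 powr (- x)) *\<^sub>R kron (mat 1 :: 'a operator) \<sigma>)" for x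
  proof -
    have "(2 powr (- x)) *\<^sub>R kron (mat 1 :: 'a operator) \<sigma> =
        kron (mat 1) V ** diag_op (\<lambda>p. 2 powr (- x) * s (snd p)) ** adj (kron (mat 1) V)"
      by (simp add: V kron_unitary_conj kron_diag_op diag_op_scaleR[symmetric] scaleR_matrix_mult)
    then show ?thesis by (simp add: psd_congruence psd_diag_op V)
  qed
  then have "min_entropy_rel (0 :: ('a \<times> 'b) operator) \<sigma> = Sup (range ereal)"
    by (simp add: min_entropy_rel_def)
  also have "\<dots> = \<infinity>"
    by (rule SUP_PInfty) auto
  finally have "\<infinity> \<le> min_entropy (0 :: ('a \<times> 'b) operator)"
    unfolding min_entropy_def using \<sigma> by (intro SUP_upper2[of \<sigma>]) auto
  with \<open>0 \<in> eps_ball \<epsilon> \<rho>\<close> have "\<infinity> \<le> smooth_min_entropy \<epsilon> \<rho>"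
    unfolding smooth_min_entropy_def by (rule SUP_upper2)
  then show ?thesis by simp
qed

theorem theorem9:
  fixes \<rho> :: "('a::finite \<times> 'b::finite) operator"
    and \<epsilon> \<eta> :: real
    and n :: nat
  assumes "\<rho> \<in> states"
    and "0 < \<epsilon>" and "\<epsilon> \<le> sqrt 2"
    and "\<eta> = real_of_ereal (Upsilon \<rho> (ptrace_A \<rho>))"
    and "n = CARD('k::finite)"
    and "real n \<ge> 8 / 5 * log 2 (2 / \<epsilon>\<^sup>2)"
  shows "ereal (1 / real n) *
           smooth_min_entropy \<epsilon>
             (regroup (tensor_power \<rho>) :: (('k \<Rightarrow> 'a) \<times> ('k \<Rightarrow> 'b)) operator)
         \<ge> cond_entropy \<rho> - ereal (delta \<epsilon> \<eta> / sqrt (real n))"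
proof (cases "\<epsilon> < 1")
  \<comment> \<open>For \<open>\<epsilon> \<ge> 1\<close> the smooth min-entropy is infinite; the
    i.i.d. estimate covers the remaining range.\<close>
  case False
  have "0 < real n" using assms(5) by simp
  then have "ereal (1 / real n) * smooth_min_entropy \<epsilon>
             (regroup (tensor_power \<rho>) :: (('k \<Rightarrow> 'a) \<times> ('k \<Rightarrow> 'b)) operator) = \<infinity>"
    using False by (simp add: smooth_min_entropy_eq_PInfty)
  then show ?thesis by simp
next
  case True
  obtain U r V l where "marginal_decomposition \<rho> U r V l"
    by (rule marginal_decomposition_exists[OF assms(1)])
  then interpret marginal_decomposition \<rho> U r V l .
  have \<eta>: "\<eta> = moment (1/2) + moment (- 1/2) + 1"
    using assms(4) by (simp add: Upsilon_marginal)
  have n: "0 < real n" using assms(5) by simp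
  have "ereal (real n * entropy - delta \<epsilon> \<eta> * sqrt n) \<le>
    smooth_min_entropy \<epsilon> (regroup (tensor_power \<rho>) :: (('k \<Rightarrow> 'a) \<times> ('k \<Rightarrow> 'b)) operator)"
    using smooth_min_entropy_iid_ge[where 'k = 'k, OF assms(2) True] assms(5,6) by (simp only: \<eta>)
  then have "ereal (1 / real n) * ereal (real n * entropy - delta \<epsilon> \<eta> * sqrt n) \<le>
    ereal (1 / real n) * smooth_min_entropy \<epsilon> (regroup (tensor_power \<rho>) :: (('k \<Rightarrow> 'a) \<times> ('k \<Rightarrow> 'b)) operator)"
    by (rule ereal_mult_left_mono) simp
  moreover have "1 / real n * (real n * entropy - delta \<epsilon> \<eta> * sqrt n) = entropy - delta \<epsilon> \<eta> / sqrt n"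
    using n by (simp add: field_simps)
  ultimately have "ereal (entropy - delta \<epsilon> \<eta> / sqrt n) \<le>
    ereal (1 / real n) * smooth_min_entropy \<epsilon> (regroup (tensor_power \<rho>) :: (('k \<Rightarrow> 'a) \<times> ('k \<Rightarrow> 'b)) operator)"
    by (simp only: times_ereal.simps)
  moreover have "cond_entropy \<rho> - ereal (delta \<epsilon> \<eta> / sqrt n) \<le> ereal entropy - ereal (delta \<epsilon> \<eta> / sqrt n)"
    using cond_entropy_le by (rule ereal_minus_mono) simp
  ultimately show ?thesis by simp
qed

end
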